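(* Let $N\ge 1$ and $N_r\ge 1$ be integers. Consider the adaptive rate cooperative ARQ protocol with at most $N_r$ relay retransmissions per packet (described in the context), and suppose that the channel gains for the transmission and the retransmissions of a packet are independent, i.e. the SNRs $\gamma_1,\gamma_2^1,\dots,\gamma_2^{N_r}$ are mutually independent. Then the average spectral efficiency $\eta$ is given by $$\eta = \sum_{n=1}^{N} \frac{1-(1-\varepsilon_n)\overline{PER}_n^{sd}}{L(n,\underline{m}^{(0)})} P_n^{sd} + \sum_{l=1}^{N_r-1} \sum_{n=1}^{N} \sum_{m_1=1}^{N} \cdots \sum_{m_l=1}^{N} \frac{1-\varepsilon_n}{L(n,\underline{m}^{(l)})}\, \overline{PER}_n^{sd} P_n^{sd} \left(\prod_{k=1}^{l-1} \overline{PER}_{m_k}^{rd} P_{m_k}^{rd}\right) \left(1 - \overline{PER}_{m_l}^{rd}\right) P_{m_l}^{rd}$$ $$\qquad + \sum_{n=1}^{N} \sum_{m_1=1}^{N} \cdots \sum_{m_{N_r}=1}^{N} \frac{(1-\varepsilon_n)\overline{PER}_n^{sd} P_n^{sd} P_{m_{N_r}}^{rd}}{L(n,\underline{m}^{(N_r)})} \prod_{k=1}^{N_r-1} \overline{PER}_{m_k}^{rd} P_{m_k}^{rd},$$ where $\varepsilon_n = PER_n(\gamma_{sr})$, $\underline{m}^{(l)}=(m_1,\dots,m_l)$, $L(n,\underline{m}^{(l)}) = 1/R_n + \sum_{k=1}^{l} 1/R_{m_k}$ (so $L(n,\underline m^{(0)})=1/R_n$), $P_n^{sd} = \int_{\gamma_{1,n}}^{\gamma_{1,n+1}}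 p_{\gamma_1}(\gamma)\, d\gamma$, $P_{m}^{rd} = \int_{\gamma_{2,m}}^{\gamma_{2,m+1}} p_{\gamma_2}(\gamma)\, d\gamma$, and $$\overline{PER}_n^{sd} = \frac{1}{P_n^{sd}} \int_{\gamma_{1,n}}^{\gamma_{1,n+1}} PER_n(\gamma)\, p_{\gamma_1}(\gamma)\, d\gamma,\qquad \overline{PER}_{m}^{rd} = \frac{1}{P_{m}^{rd}} \int_{\gamma_{2,m}}^{\gamma_{2,m+1}} PER_{m}(\gamma)\, p_{\gamma_2}(\gamma)\, d\gamma .$$ Empty sums are $0$ and empty products are $1$.
   Context: Setting: a source S, a relay R and a destination D. The adaptive modulation and coding (AMC) modes are $0,1,\dots,N$ with rates $R_0=0$ and $R_n>0$ for $n\ge1$ (bits per symbol), the same rate set for S and R. Mode $0$ is the outage mode, in which nothing is transmitted. The S-D channel SNR $\gamma_1\ge 0$ has probability density $p_{\gamma_1}$. The R-D channel SNR in the $k$-th relay retransmission is $\gamma_2^k\ge0$, $k=1,\dots,N_r$, and each $\gamma_2^k$ has the same density $p_{\gamma_2}$. The S-R channel SNR is a constant $\gamma_{sr}$. Switching thresholds are $0=\gamma_{1,0}<\gamma_{1,1}<\dots<\gamma_{1,N}<\gamma_{1,N+1}=\infty$ and $0=\gamma_{2,0}<\gamma_{2,1}<\dots<\gamma_{2,N}<\gamma_{2,N+1}=\infty$. The source uses the mode $n$ with $\gamma_1\in[\gamma_{1,n},\gamma_{1,n+1})$. In the $k$-th retransmission the relay uses the mode $m_k$ with $\gamma_2^k\in[\gamma_{2,m_k},\gamma_{2,m_k+1})$.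 All $P_n^{sd}$, $P_m^{rd}$ with $n,m\ge 1$ are positive. $PER_n:[0,\infty)\to[0,1]$ (measurable) is the packet error rate of mode $n$ as a function of SNR. Let $T_{sd}$, $T_{sr}$, $T_{rd}^k$ ($k=1,\dots,N_r$) take values in $\{s,f\}$ (success/failure) and denote the outcomes of the S-D transmission, of the S-R reception, and of the $k$-th relay retransmission. Given the SNRs these outcomes are independent, with $\Pr(T_{sd}=f)=PER_n(\gamma_1)$, $\Pr(T_{sr}=f)=\varepsilon_n$, $\Pr(T_{rd}^k=f)=PER_{m_k}(\gamma_2^k)$. Protocol: S broadcasts the packet. If D fails and R has decoded the packet, R retransmits it until D receives it correctly or $N_r$ retransmissions have been made. The number $M$ of relay retransmissions is therefore: $M=0$ if $T_{sd}=s$, or if $T_{sd}=f$ and $T_{sr}=f$; $M=k$ (for $1\le k\le N_r-1$) if $T_{sd}=f$, $T_{sr}=s$, $T_{rd}^1=\dots=T_{rd}^{k-1}=f$ and $T_{rd}^k=s$; $M=N_r$ if $T_{sd}=f$, $T_{sr}=s$, $T_{rd}^1=\dots=T_{rd}^{N_r-1}=f$. The instantaneous spectral efficiency is the number of packet bits divided by the total number of symbols used, $1/L(n,\underline m^{(M)})$. It is taken to be $0$ whenever at least one of the modes $n,m_1,\dots,m_M$ is the outage mode $0$ (convention $1/R_0=\infty$). The average spectral efficiency is $\eta=E\left[1/L(n,\underline m^{(M)})\right]$, the expectation being over all SNRs and outcomes. *)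

theory Defs
  imports "HOL-Probability.Probability"
begin

datatype outcome = Success | Failure

text \<open>Index of the AMC mode used at SNR \<open>x \<ge> 0\<close>. The thresholds are extended reals, with
  \<open>th 0 = 0\<close> and \<open>th (N + 1) = \<infinity>\<close>, so exactly one mode qualifies.\<close>

definition amc_mode :: "nat \<Rightarrow> (nat \<Rightarrow> ereal) \<Rightarrow> real \<Rightarrow> nat" where
  "amc_mode N th x = (THE n. n \<le> N \<and> th n \<le> ereal x \<and> ereal x < th (Suc n))"

definition mode_prob :: "(nat \<Rightarrow> ereal) \<Rightarrow> (real \<Rightarrow> real) \<Rightarrow> nat \<Rightarrow> real" where
  "mode_prob th p n = (LBINT x=th n..th (Suc n). p x)"

definition avg_PER ::
  "(nat \<Rightarrow> real \<Rightarrow> real) \<Rightarrow> (nat \<Rightarrow> ereal) \<Rightarrow> (real \<Rightarrow> real) \<Rightarrow> nat \<Rightarrow> real" where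
  "avg_PER PER th p n = 1 / mode_prob th p n * (LBINT x=th n..th (Suc n). PER n x * p x)"

text \<open>Symbols per packet bit when the source uses mode \<open>n\<close> and \<open>l\<close> relay retransmissions
  use the modes \<open>m 1, \<dots>, m l\<close>. As \<open>1 / 0 = 0\<close> in HOL, the value is only meaningful if none of
  these modes is the outage mode \<open>0\<close>; that case is treated in \<open>spectral_efficiency\<close>.\<close>

definition symbols_per_bit :: "(nat \<Rightarrow> real) \<Rightarrow> nat \<Rightarrow> (nat \<Rightarrow> nat) \<Rightarrow> nat \<Rightarrow> real" where
  "symbols_per_bit R n m l = 1 / R n + (\<Sum>k=1..l. 1 / R (m k))"

definition spectral_efficiency :: "(nat \<Rightarrow> real) \<Rightarrow> nat \<Rightarrow> (nat \<Rightarrow> nat) \<Rightarrow> nat \<Rightarrow> real" where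
  "spectral_efficiency R n m l =
     (if n = 0 \<or> (\<exists>k\<in>{1..l}. m k = 0) then 0 else 1 / symbols_per_bit R n m l)"

text \<open>The outcome of the last possible retransmission \<open>Nr\<close> has no influence on the number of
  retransmissions.\<close>

definition num_retransmissions ::
  "nat \<Rightarrow> outcome \<Rightarrow> outcome \<Rightarrow> (nat \<Rightarrow> outcome) \<Rightarrow> nat" where
  "num_retransmissions Nr tsd tsr trd =
     (if tsd = Success \<or> tsr = Failure then 0
      else if \<exists>k\<in>{1..Nr - 1}. trd k = Success
      then (LEAST k. k \<in> {1..Nr - 1} \<and> trd k = Success)
      else Nr)"

text \<open>The sub-\<open>\<sigma>\<close>-algebra of \<open>M\<close> generated by all SNRs.\<close>

definition snr_algebra ::
  "'w measure \<Rightarrow> nat \<Rightarrow> ('w \<Rightarrow> real) \<Rightarrow> (nat \<Rightarrow> 'w \<Rightarrow> real) \<Rightarrow> 'w measure" where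
  "snr_algebra M Nr \<gamma>1 \<gamma>2 =
     vimage_algebra (space M) (\<lambda>\<omega>. (\<gamma>1 \<omega>, \<lambda>k\<in>{1..Nr}. \<gamma>2 k \<omega>))
       (borel \<Otimes>\<^sub>M (\<Pi>\<^sub>M k\<in>{1..Nr}. borel))"

definition cond_prob_alg :: "'w measure \<Rightarrow> 'w measure \<Rightarrow> ('w \<Rightarrow> bool) \<Rightarrow> 'w \<Rightarrow> real" where
  "cond_prob_alg M F Q = real_cond_exp M F (indicator {\<omega> \<in> space M. Q \<omega>})"

definition avg_spectral_efficiency ::
  "'w measure \<Rightarrow> nat \<Rightarrow> nat \<Rightarrow> (nat \<Rightarrow> real) \<Rightarrow> (nat \<Rightarrow> ereal) \<Rightarrow> (nat \<Rightarrow> ereal) \<Rightarrow>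
   ('w \<Rightarrow> real) \<Rightarrow> (nat \<Rightarrow> 'w \<Rightarrow> real) \<Rightarrow>
   ('w \<Rightarrow> outcome) \<Rightarrow> ('w \<Rightarrow> outcome) \<Rightarrow> (nat \<Rightarrow> 'w \<Rightarrow> outcome) \<Rightarrow> real" where
  "avg_spectral_efficiency M N Nr R th1 th2 \<gamma>1 \<gamma>2 Tsd Tsr Trd =
     (LINT \<omega>|M. spectral_efficiency R
        (amc_mode N th1 (\<gamma>1 \<omega>)) (\<lambda>k. amc_mode N th2 (\<gamma>2 k \<omega>))
        (num_retransmissions Nr (Tsd \<omega>) (Tsr \<omega>) (\<lambda>k. Trd k \<omega>)))"

end

theory Submission
  imports Defs
begin

text \<open>The efficiency splits over the number of retransmissions. The event that this number is
  \<open>l\<close> fixes the outcomes of the source, of the relay reception and of some of the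
  retransmissions, so conditioning on all SNRs turns its indicator into a product of functions of
  the single SNRs. Expanding the efficiency over the cells in which the SNRs lie makes the whole
  integrand a finite sum of such products, and independence of the SNRs factorises each expectation
  into one-dimensional integrals over cells.\<close>

section \<open>Modes and SNR cells\<close>

text \<open>Independence given the SNRs is assumed for complete outcome patterns, whereas the event
  of exactly l retransmissions with l < Nr leaves later outcomes free; these have to be integrated
  out. Zero retransmissions is treated as the complement of the event that D fails and R decodes,
  which is where the factor 1 - (1 - \<epsilon> n) PER comes from. The reception error depends on
  the source mode, hence on \<gamma>1, so it must be merged with the S-D error rate into a single
  factor before independence of the SNRs can be used. The last possible retransmission contributes a
  bare mode probability, because its mode affects the efficiency while its outcome is left open.
  Outage modes disappear because the efficiency is 0 there. Error rates are controlled only on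
  [0,\<infinity>), so they are multiplied by cell indicators before being treated as Borel functions
  on the line.\<close>

definition mode_cell :: "(nat \<Rightarrow> ereal) \<Rightarrow> nat \<Rightarrow> real set" where
  "mode_cell th n = {x. th n \<le> ereal x \<and> ereal x < th (Suc n)}"

lemma mode_cell_borel [measurable]: "mode_cell th n \<in> sets borel"
  unfolding mode_cell_def by measurable

text \<open>Every averaged error rate in the final formula is multiplied by the probability of its
  mode, so only this unnormalised integral has to be computed.\<close>

lemma avg_PER_mult_mode_prob:
  "mode_prob th p n \<noteq> 0 \<Longrightarrow>
    (LBINT x=th n..th (Suc n). PER n x * p x) = avg_PER PER th p n * mode_prob th p n"
  by (simp add: avg_PER_def)

locale thresholds =
  fixes N :: nat and th :: "nat \<Rightarrow> ereal"
  assumes th_0: "th 0 = 0" and th_top: "th (Suc N) = \<infinity>"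
    and th_strict_mono: "strict_mono_on {0..Suc N} th"
begin

lemma th_mono: "i \<le> j \<Longrightarrow> j \<le> Suc N \<Longrightarrow> th i \<le> th j"
  using th_strict_mono by (cases "i = j") (auto simp: strict_mono_on_def less_imp_le)

lemma th_less_Suc: "n \<le> N \<Longrightarrow> th n < th (Suc n)"
  using th_strict_mono by (auto simp: strict_mono_on_def)

lemma mode_cell_nonneg: "n \<le> N \<Longrightarrow> mode_cell th n \<subseteq> {0..}"
  using th_mono[of 0 n] th_0 by (auto simp: mode_cell_def zero_ereal_def dest: order_trans)

lemma mode_cell_unique:
  assumes "x \<in> mode_cell th i" "x \<in> mode_cell th j" "i \<le> N" "j \<le> N"
  shows "i = j"
proof (rule ccontr)
  assume "i \<noteq> j"
  then consider "Suc i \<le> j" | "Suc j \<le> i" by linarith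
  then show False
    using assms th_mono[of "Suc i" j] th_mono[of "Suc j" i]
    by cases (auto simp: mode_cell_def)
qed

lemma mode_cell_exists:
  assumes "0 \<le> x"
  shows "\<exists>n\<le>N. x \<in> mode_cell th n"
proof -
  \<comment> \<open>The least upper threshold above \<open>x\<close> exists because the top one is
    infinite. Minimality at the predecessor of \<open>n\<close> is exactly the lower bound
    \<open>th n \<le> ereal x\<close>; for \<open>n = 0\<close> the bound is
    \<open>0 \<le> x\<close>.\<close>
  define n where "n = (LEAST k. ereal x < th (Suc k))"
  have ex: "ereal x < th (Suc N)" by (simp add: th_top)
  have lt: "ereal x < th (Suc n)" unfolding n_def
    by (rule LeastI[where P="\<lambda>k. ereal x < th (Suc k)", OF ex])
  have "n \<le> N" unfolding n_def
    by (rule Least_le[where P="\<lambda>k. ereal x < th (Suc k)", OF ex])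
  moreover have "th n \<le> ereal x"
  proof (cases n)
    case 0
    then show ?thesis using assms th_0 by simp
  next
    case (Suc k)
    then have "\<not> ereal x < th (Suc k)" using not_less_Least[of k "\<lambda>k. ereal x < th (Suc k)"]
      by (simp add: n_def)
    then show ?thesis using Suc by simp
  qed
  ultimately show ?thesis using lt by (auto simp: mode_cell_def)
qed

text \<open>Existence and uniqueness of the cell make the definite description in
  \<open>amc_mode\<close> meaningful. A negative SNR lies in no cell up to \<open>N\<close>, which
  is why nonnegativity accompanies every later use.\<close>

lemma amc_mode_cell:
  assumes "0 \<le> x"
  shows amc_mode_le: "amc_mode N th x \<le> N"
    and amc_mode_in_cell: "x \<in> mode_cell th (amc_mode N th x)"
proof -
  have "\<exists>!n. n \<le> N \<and> th n \<le> ereal x \<and> ereal x < th (Suc n)"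
    using mode_cell_exists[OF assms] mode_cell_unique[of x]
    by (auto simp: mode_cell_def)
  from theI'[OF this] show "amc_mode N th x \<le> N" "x \<in> mode_cell th (amc_mode N th x)"
    by (auto simp: amc_mode_def mode_cell_def)
qed

lemma amc_mode_eq_iff:
  "0 \<le> x \<Longrightarrow> n \<le> N \<Longrightarrow> amc_mode N th x = n \<longleftrightarrow> x \<in> mode_cell th n"
  using amc_mode_cell[of x] mode_cell_unique[of x] by blast

text \<open>Preimages are finite unions of preimages of cells. The space \<open>G\<close> is
  arbitrary because the result is applied both to \<open>M\<close> and to the SNR algebra.\<close>

lemma measurable_amc_mode:
  assumes X [measurable]: "X \<in> borel_measurable G" and nn: "\<And>\<omega>. \<omega> \<in> space G \<Longrightarrow> 0 \<le> X \<omega>"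
  shows "(\<lambda>\<omega>. amc_mode N th (X \<omega>)) \<in> measurable G (count_space UNIV)"
proof (rule measurableI)
  fix A :: "nat set"
  have "(\<lambda>\<omega>. amc_mode N th (X \<omega>)) -` A \<inter> space G
      = (\<Union>n\<in>A \<inter> {..N}. X -` mode_cell th n \<inter> space G)"
    using amc_mode_eq_iff[OF nn] amc_mode_le[OF nn] amc_mode_in_cell[OF nn] by fastforce
  also have "\<dots> \<in> sets G" by (intro sets.finite_UN) auto
  finally show "(\<lambda>\<omega>. amc_mode N th (X \<omega>)) -` A \<inter> space G \<in> sets G" .
qed auto

lemma measurable_at_amc_mode:
  fixes f :: "nat \<Rightarrow> real \<Rightarrow> real"
  assumes X [measurable]: "X \<in> borel_measurable G" and nn: "\<And>\<omega>. \<omega> \<in> space G \<Longrightarrow> 0 \<le> X \<omega>"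
    and f: "\<And>n. n \<le> N \<Longrightarrow> f n \<in> borel_measurable (restrict_space borel {0..})"
  shows "(\<lambda>\<omega>. f (amc_mode N th (X \<omega>)) (X \<omega>)) \<in> borel_measurable G"
proof -
  \<comment> \<open>Composition with a countable-valued index asks for measurability at every
    natural number, but \<open>f n\<close> is controlled only for \<open>n \<le> N\<close>; the
    cut-off fills the remaining indices with 0.\<close>
  let ?f = "\<lambda>n \<omega>. if n \<le> N then f n (X \<omega>) else 0"
  have "X \<in> measurable G (restrict_space borel {0..})"
    using nn by (intro measurable_restrict_space2) auto
  then have *: "?f n \<in> borel_measurable G" for n
    using measurable_compose[OF _ f] by (cases "n \<le> N") auto
  have "(\<lambda>\<omega>. ?f (amc_mode N th (X \<omega>)) \<omega>) \<in> borel_measurable G"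
    by (rule measurable_compose_countable[OF * measurable_amc_mode[OF X nn]])
  then show ?thesis
    by (rule measurable_cong[THEN iffD1, rotated]) (use amc_mode_le[OF nn] in auto)
qed

text \<open>Cells up to \<open>N\<close> lie in the half line on which \<open>f\<close> is
  measurable, so cutting \<open>f\<close> off outside the cell gives the same function as first
  extending it by 0 to negative arguments.\<close>

lemma borel_measurable_mode_cell:
  fixes f :: "real \<Rightarrow> real"
  assumes f: "f \<in> borel_measurable (restrict_space borel {0..})" and n: "n \<le> N"
  shows "(\<lambda>x. indicator (mode_cell th n) x * f x) \<in> borel_measurable borel"
proof -
  have [measurable]: "(\<lambda>x. f x * indicator {0..} x) \<in> borel_measurable borel"
    using f by (simp add: borel_measurable_restrict_space_iff mult.commute)
  have "(\<lambda>x. indicator (mode_cell th n) x * (f x * indicator {0..} x)) \<in> borel_measurable borel"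
    by measurable
  also have "(\<lambda>x. indicator (mode_cell th n) x * (f x * indicator {0..} x))
      = (\<lambda>x. indicator (mode_cell th n) x * f x)"
    using mode_cell_nonneg[OF n] by (force simp: indicator_def fun_eq_iff)
  finally show ?thesis .
qed

lemma integral_mode_cell:
  fixes f :: "real \<Rightarrow> real"
  assumes D: "distributed M lborel X (\<lambda>x. ennreal (p x))" and p: "\<And>x. 0 \<le> p x"
    and f: "f \<in> borel_measurable (restrict_space borel {0..})" and n: "n \<le> N"
  shows "(LINT \<omega>|M. indicator (mode_cell th n) (X \<omega>) * f (X \<omega>))
       = (LBINT x=th n..th (Suc n). f x * p x)"
proof -
  let ?g = "\<lambda>x. indicator (mode_cell th n) x * f x"
  let ?I = "indicator (einterval (th n) (th (Suc n))) :: real \<Rightarrow> real"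
  have [measurable]: "p \<in> borel_measurable borel"
    using distributed_real_measurable[OF _ D] p by simp
  have g [measurable]: "?g \<in> borel_measurable borel"
    by (rule borel_measurable_mode_cell[OF f n])
  have cell: "?I x * ?g x = ?I x * f x" for x
    by (auto simp: indicator_def mode_cell_def einterval_def)
  have "(LINT \<omega>|M. ?g (X \<omega>)) = (LBINT x. p x * ?g x)"
    by (rule distributed_integral[OF D _, symmetric]) (use p in auto)
  \<comment> \<open>Cells contain their left endpoint, interval integrals do not; a single point is
    a null set. The factor \<open>?g\<close> stays in place for now because \<open>f\<close> alone
    need not be Borel on the whole line.\<close>
  also have "\<dots> = (LBINT x. p x * (?I x * ?g x))"
  proof (rule integral_cong_AE)
    have "AE x in lborel. x \<noteq> real_of_ereal (th n)" by (rule AE_lborel_singleton)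
    then show "AE x in lborel. p x * ?g x = p x * (?I x * ?g x)"
      by eventually_elim (auto simp: indicator_def mode_cell_def einterval_def less_le)
  qed simp_all
  also have "\<dots> = (LBINT x. ?I x * (f x * p x))"
    unfolding cell by (simp add: mult_ac)
  finally show ?thesis
    using th_less_Suc[OF n]
    by (simp add: interval_lebesgue_integral_def set_lebesgue_integral_def less_imp_le)
qed

text \<open>The subtraction is carried out on the probability space, where both integrands are
  bounded by 1 and hence integrable; \<open>integral_mode_cell\<close> then translates each term
  into an interval integral.\<close>

lemma interval_integral_one_minus:
  fixes f :: "real \<Rightarrow> real"
  assumes M: "prob_space M"
    and D: "distributed M lborel X (\<lambda>x. ennreal (p x))" and p: "\<And>x. 0 \<le> p x"
    and f: "f \<in> borel_measurable (restrict_space borel {0..})"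
    and f1: "\<And>x. 0 \<le> x \<Longrightarrow> f x \<in> {0..1}" and n: "n \<le> N"
  shows "(LBINT x=th n..th (Suc n). (1 - f x) * p x)
       = mode_prob th p n - (LBINT x=th n..th (Suc n). f x * p x)"
proof -
  interpret prob_space M by fact
  have X [measurable]: "X \<in> borel_measurable M"
    using distributed_measurable[OF D] by simp
  let ?I = "\<lambda>\<omega>. indicator (mode_cell th n) (X \<omega>) :: real"
  have int: "integrable M (\<lambda>\<omega>. ?I \<omega> * f (X \<omega>))"
    using measurable_compose[OF X borel_measurable_mode_cell[OF f n]] f1 mode_cell_nonneg[OF n]
    by (intro integrable_const_bound[where B=1] AE_I2) (force simp: indicator_def)+
  have int1: "integrable M (\<lambda>\<omega>. ?I \<omega> * 1)"
    by (rule integrable_const_bound[where B=1]) (auto simp: indicator_def)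
  have "(LBINT x=th n..th (Suc n). (1 - f x) * p x) = (LINT \<omega>|M. ?I \<omega> * (1 - f (X \<omega>)))"
    using f by (intro integral_mode_cell[OF D p _ n, symmetric]) auto
  also have "\<dots> = (LINT \<omega>|M. ?I \<omega> * 1 - ?I \<omega> * f (X \<omega>))"
    by (simp add: algebra_simps)
  also have "\<dots> = (LINT \<omega>|M. ?I \<omega> * 1) - (LINT \<omega>|M. ?I \<omega> * f (X \<omega>))"
    using int int1 by (rule Bochner_Integration.integral_diff[rotated])
  also have "(LINT \<omega>|M. ?I \<omega> * 1) = mode_prob th p n"
    by (subst integral_mode_cell[OF D p _ n]) (simp_all add: mode_prob_def)
  also have "(LINT \<omega>|M. ?I \<omega> * f (X \<omega>)) = (LBINT x=th n..th (Suc n). f x * p x)"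
    by (rule integral_mode_cell[OF D p f n])
  finally show ?thesis .
qed

end

section \<open>Conditional probabilities\<close>

text \<open>The characterising property of conditional expectation, with a bounded
  \<open>F\<close>-measurable weight \<open>h\<close>: under the integral, the indicator may be
  replaced by any measurable function that agrees almost everywhere with its conditional
  probability.\<close>

lemma (in prob_space) integral_mult_cond_prob:
  assumes sub: "subalgebra M F" and Q [measurable]: "{\<omega> \<in> space M. Q \<omega>} \<in> sets M"
    and h: "h \<in> borel_measurable F" and hB: "\<And>\<omega>. \<omega> \<in> space M \<Longrightarrow> \<bar>h \<omega>\<bar> \<le> B"
    and w [measurable]: "w \<in> borel_measurable M"
    and ae: "AE \<omega> in M. cond_prob_alg M F Q \<omega> = w \<omega>"
  shows "(LINT \<omega>|M. h \<omega> * of_bool (Q \<omega>)) = (LINT \<omega>|M. h \<omega> * w \<omega>)"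
proof -
  interpret finite_measure_subalgebra M F by unfold_locales (rule sub)
  have [measurable]: "h \<in> borel_measurable M" by (rule measurable_from_subalg[OF sub h])
  have [measurable]: "real_cond_exp M F (indicator {\<omega> \<in> space M. Q \<omega>}) \<in> borel_measurable M"
    by (rule borel_measurable_cond_exp2)
  have "(LINT \<omega>|M. h \<omega> * of_bool (Q \<omega>)) = (LINT \<omega>|M. h \<omega> * indicator {\<omega> \<in> space M. Q \<omega>} \<omega>)"
    by (intro Bochner_Integration.integral_cong) (auto simp: indicator_def)
  also have "\<dots> = (LINT \<omega>|M. h \<omega> * real_cond_exp M F (indicator {\<omega> \<in> space M. Q \<omega>}) \<omega>)"
  proof (rule real_cond_exp_intg(2)[symmetric])
    show "integrable M (\<lambda>\<omega>. h \<omega> * indicator {\<omega> \<in> space M. Q \<omega>} \<omega>)"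
      by (rule integrable_const_bound[where B="\<bar>B\<bar>"])
         (use hB in \<open>auto simp: indicator_def intro!: AE_I2 order_trans[OF hB]\<close>)
  qed (use h in auto)
  also have "\<dots> = (LINT \<omega>|M. h \<omega> * w \<omega>)"
    using ae by (intro integral_cong_AE) (auto simp: cond_prob_alg_def)
  finally show ?thesis .
qed

text \<open>The model prescribes failure probabilities only. The two outcome indicators add up to 1,
  so linearity of conditional expectation supplies the other case.\<close>

lemma (in prob_space) cond_prob_Success:
  assumes sub: "subalgebra M F" and T [measurable]: "T \<in> measurable M (count_space UNIV)"
    and ae: "AE \<omega> in M. cond_prob_alg M F (\<lambda>\<omega>. T \<omega> = Failure) \<omega> = w \<omega>"
  shows "AE \<omega> in M. cond_prob_alg M F (\<lambda>\<omega>. T \<omega> = Success) \<omega> = 1 - w \<omega>"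
proof -
  interpret finite_measure_subalgebra M F by unfold_locales (rule sub)
  let ?f = "indicator {\<omega> \<in> space M. T \<omega> = Failure} :: _ \<Rightarrow> real"
  let ?s = "indicator {\<omega> \<in> space M. T \<omega> = Success} :: _ \<Rightarrow> real"
  have "AE \<omega> in M. real_cond_exp M F ?s \<omega> = real_cond_exp M F (\<lambda>\<omega>. 1 - ?f \<omega>) \<omega>"
    by (rule real_cond_exp_cong) (auto simp: indicator_def intro!: AE_I2 intro: outcome.exhaust)
  moreover have "AE \<omega> in M. real_cond_exp M F (\<lambda>\<omega>. 1 - ?f \<omega>) \<omega>
      = real_cond_exp M F (\<lambda>_. 1) \<omega> - real_cond_exp M F ?f \<omega>"
    by (rule real_cond_exp_diff) (auto simp: emeasure_eq_measure)
  moreover have "AE \<omega> in M. real_cond_exp M F (\<lambda>_. 1) \<omega> = 1"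
    by (rule real_cond_exp_F_meas) auto
  ultimately show ?thesis
    using ae unfolding cond_prob_alg_def by eventually_elim simp
qed

lemma (in prob_space) integrable_mult_01:
  assumes h [measurable]: "h \<in> borel_measurable M"
    and hB: "\<And>\<omega>. \<omega> \<in> space M \<Longrightarrow> \<bar>h \<omega>\<bar> \<le> B"
    and g [measurable]: "g \<in> borel_measurable M"
    and g1: "\<And>\<omega>. \<omega> \<in> space M \<Longrightarrow> g \<omega> \<in> {0..1::real}"
  shows "integrable M (\<lambda>\<omega>. h \<omega> * g \<omega>)"
proof (rule integrable_const_bound[where B=B])
  have "\<bar>h \<omega> * g \<omega>\<bar> \<le> B * 1" if "\<omega> \<in> space M" for \<omega>
    unfolding abs_mult using hB[OF that] g1[OF that] by (intro mult_mono) auto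
  then show "AE \<omega> in M. norm (h \<omega> * g \<omega>) \<le> B" by auto
qed measurable

text \<open>Summing out one retransmission at a time extends the product formula from complete
  outcome patterns to partial ones.\<close>

lemma marginal_integral:
  fixes T :: "'i \<Rightarrow> 'w \<Rightarrow> outcome" and q :: "'i \<Rightarrow> outcome \<Rightarrow> 'w \<Rightarrow> real"
  assumes fin: "finite I" and J: "J \<subseteq> I"
    and full: "\<And>c. (LINT \<omega>|M. h \<omega> * of_bool (Q \<omega> \<and> (\<forall>k\<in>I. T k \<omega> = c k)))
                  = (LINT \<omega>|M. h \<omega> * (w \<omega> * (\<Prod>k\<in>I. q k (c k) \<omega>)))"
    and int1: "\<And>K c. K \<subseteq> I \<Longrightarrow> integrable M (\<lambda>\<omega>. h \<omega> * of_bool (Q \<omega> \<and> (\<forall>k\<in>K. T k \<omega> = c k)))"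
    and int2: "\<And>K c. K \<subseteq> I \<Longrightarrow> integrable M (\<lambda>\<omega>. h \<omega> * (w \<omega> * (\<Prod>k\<in>K. q k (c k) \<omega>)))"
    and q: "\<And>k \<omega>. k \<in> I \<Longrightarrow> \<omega> \<in> space M \<Longrightarrow> q k Success \<omega> + q k Failure \<omega> = 1"
  shows "(LINT \<omega>|M. h \<omega> * of_bool (Q \<omega> \<and> (\<forall>k\<in>J. T k \<omega> = c k)))
       = (LINT \<omega>|M. h \<omega> * (w \<omega> * (\<Prod>k\<in>J. q k (c k) \<omega>)))"
proof -
  let ?P = "\<lambda>J. \<forall>c. (LINT \<omega>|M. h \<omega> * of_bool (Q \<omega> \<and> (\<forall>k\<in>J. T k \<omega> = c k)))
       = (LINT \<omega>|M. h \<omega> * (w \<omega> * (\<Prod>k\<in>J. q k (c k) \<omega>)))"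
  \<comment> \<open>Induction on the set \<open>D\<close> of coordinates already summed out:
    \<open>D\<close> empty is the complete pattern, \<open>I - J\<close> is the goal. The pattern is
    quantified inside \<open>?P\<close> because the step uses the hypothesis for two patterns that
    differ at \<open>d\<close>.\<close>
  have "?P (I - D)" if "finite D" for D
    using that
  proof (induction D)
    case empty
    then show ?case using full by simp
  next
    case (insert d D)
    show ?case
    proof (cases "d \<in> I")
      case False
      then have "I - insert d D = I - D" by auto
      then show ?thesis using insert.IH by simp
    next
      case True
      define K where "K = I - insert d D"
      have K: "I - D = insert d K" "d \<notin> K" "insert d K \<subseteq> I" "K \<subseteq> I" "finite K"
        using True insert.hyps fin by (auto simp: K_def)
      have IH: "(LINT \<omega>|M. h \<omega> * of_bool (Q \<omega> \<and> (\<forall>k\<in>insert d K. T k \<omega> = c k)))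
         = (LINT \<omega>|M. h \<omega> * (w \<omega> * (\<Prod>k\<in>insert d K. q k (c k) \<omega>)))" for c
        using insert.IH K(1) by simp
      have "(LINT \<omega>|M. h \<omega> * of_bool (Q \<omega> \<and> (\<forall>k\<in>K. T k \<omega> = c k)))
          = (LINT \<omega>|M. h \<omega> * (w \<omega> * (\<Prod>k\<in>K. q k (c k) \<omega>)))" for c
      proof -
        have upd: "(\<forall>k\<in>insert d K. T k \<omega> = (c(d := x)) k) \<longleftrightarrow> T d \<omega> = x \<and> (\<forall>k\<in>K. T k \<omega> = c k)" for x \<omega>
          using K(2) by auto
        have updq: "(\<Prod>k\<in>insert d K. q k ((c(d := x)) k) \<omega>) = q d x \<omega> * (\<Prod>k\<in>K. q k (c k) \<omega>)" for x \<omega>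
        proof -
          have "(\<Prod>k\<in>K. q k ((c(d := x)) k) \<omega>) = (\<Prod>k\<in>K. q k (c k) \<omega>)"
            using K(2) by (intro prod.cong) auto
          then show ?thesis using K(2,5) by simp
        qed
        have "(LINT \<omega>|M. h \<omega> * of_bool (Q \<omega> \<and> (\<forall>k\<in>K. T k \<omega> = c k)))
          = (LINT \<omega>|M. h \<omega> * of_bool (Q \<omega> \<and> (\<forall>k\<in>insert d K. T k \<omega> = (c(d := Success)) k))
              + h \<omega> * of_bool (Q \<omega> \<and> (\<forall>k\<in>insert d K. T k \<omega> = (c(d := Failure)) k)))"
          unfolding upd
        proof (rule Bochner_Integration.integral_cong[OF refl])
          fix \<omega>
          show "h \<omega> * of_bool (Q \<omega> \<and> (\<forall>k\<in>K. T k \<omega> = c k))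
            = h \<omega> * of_bool (Q \<omega> \<and> T d \<omega> = Success \<and> (\<forall>k\<in>K. T k \<omega> = c k))
            + h \<omega> * of_bool (Q \<omega> \<and> T d \<omega> = Failure \<and> (\<forall>k\<in>K. T k \<omega> = c k))"
            by (cases "T d \<omega>") auto
        qed
        also have "\<dots> = (LINT \<omega>|M. h \<omega> * (w \<omega> * (\<Prod>k\<in>insert d K. q k ((c(d := Success)) k) \<omega>)))
            + (LINT \<omega>|M. h \<omega> * (w \<omega> * (\<Prod>k\<in>insert d K. q k ((c(d := Failure)) k) \<omega>)))"
          by (simp only: Bochner_Integration.integral_add int1[OF K(3)] IH)
        also have "\<dots> = (LINT \<omega>|M. h \<omega> * (w \<omega> * (\<Prod>k\<in>insert d K. q k ((c(d := Success)) k) \<omega>))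
            + h \<omega> * (w \<omega> * (\<Prod>k\<in>insert d K. q k ((c(d := Failure)) k) \<omega>)))"
          by (simp only: Bochner_Integration.integral_add int2[OF K(3)])
        \<comment> \<open>Both products share the factors over \<open>K\<close>, and the two weights
          at \<open>d\<close> sum to 1, so coordinate \<open>d\<close> disappears.\<close>
        also have "\<dots> = (LINT \<omega>|M. h \<omega> * (w \<omega> * (\<Prod>k\<in>K. q k (c k) \<omega>)))"
        proof (rule Bochner_Integration.integral_cong[OF refl])
          fix \<omega> assume "\<omega> \<in> space M"
          then have s: "q d Success \<omega> = 1 - q d Failure \<omega>" using q[OF True] by (simp add: eq_diff_eq)
          show "h \<omega> * (w \<omega> * (\<Prod>k\<in>insert d K. q k ((c(d := Success)) k) \<omega>))
            + h \<omega> * (w \<omega> * (\<Prod>k\<in>insert d K. q k ((c(d := Failure)) k) \<omega>))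
            = h \<omega> * (w \<omega> * (\<Prod>k\<in>K. q k (c k) \<omega>))"
            unfolding updq s by (simp add: algebra_simps)
        qed
        finally show ?thesis .
      qed
      then show ?thesis by (simp add: K_def)
    qed
  qed
  from this[of "I - J"] fin J show ?thesis by (simp add: double_diff)
qed

section \<open>Spectral efficiency\<close>

text \<open>The term for 0 is written as a difference because zero retransmissions is the complement
  of one product event, while directly it would be a union. The pattern for \<open>l\<close> is
  "first success at \<open>l\<close>"; the term for \<open>Nr\<close> only asks for failures up to
  \<open>Nr - 1\<close>.\<close>

lemma num_retransmissions_split:
  fixes f :: "nat \<Rightarrow> real"
  assumes "1 \<le> Nr"
  shows "f (num_retransmissions Nr a b t)
    = f 0 - f 0 * of_bool (a = Failure \<and> b = Success)
    + (\<Sum>l=1..Nr - 1. f l * of_bool ((a = Failure \<and> b = Success) \<and>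
         (\<forall>k\<in>{1..l}. t k = (if k = l then Success else Failure))))
    + f Nr * of_bool ((a = Failure \<and> b = Success) \<and> (\<forall>k\<in>{1..Nr - 1}. t k = Failure))"
proof (cases "a = Failure \<and> b = Success")
  case False
  then have "a = Success \<or> b = Failure" using outcome.exhaust by blast
  then show ?thesis using False by (auto simp: num_retransmissions_def)
next
  case ab: True
  show ?thesis
  proof (cases "\<exists>k\<in>{1..Nr - 1}. t k = Success")
    case False
    then have F: "\<forall>k\<in>{1..Nr - 1}. t k = Failure" using outcome.exhaust by blast
    then have "(\<Sum>l=1..Nr - 1. f l * of_bool ((a = Failure \<and> b = Success) \<and>
         (\<forall>k\<in>{1..l}. t k = (if k = l then Success else Failure)))) = 0"
      by (intro sum.neutral) force
    then show ?thesis using ab F False by (simp add: num_retransmissions_def)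
  next
    case True
    define j where "j = (LEAST k. k \<in> {1..Nr - 1} \<and> t k = Success)"
    have j: "j \<in> {1..Nr - 1}" "t j = Success"
      using LeastI_ex[of "\<lambda>k. k \<in> {1..Nr - 1} \<and> t k = Success"] True
      unfolding j_def by blast+
    have F: "t k = Failure" if "1 \<le> k" "k < j" for k
    proof -
      have "\<not> (k \<in> {1..Nr - 1} \<and> t k = Success)"
        using that(2) unfolding j_def by (rule not_less_Least)
      then show ?thesis using that j(1) by (cases "t k") auto
    qed
    \<comment> \<open>Only the pattern of the first success \<open>j\<close> can match:
      \<open>l < j\<close> contradicts minimality of \<open>j\<close>, and \<open>j < l\<close>
      would force a failure at \<open>j\<close>. The sum therefore collapses to one term.\<close>
    have iff: "(\<forall>k\<in>{1..l}. t k = (if k = l then Success else Failure)) \<longleftrightarrow> l = j"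
      if "l \<in> {1..Nr - 1}" for l
    proof
      assume *: "\<forall>k\<in>{1..l}. t k = (if k = l then Success else Failure)"
      then have "t l = Success" using that by auto
      then have "\<not> l < j" using F[of l] that by auto
      moreover have "\<not> j < l" using * j by force
      ultimately show "l = j" by simp
    qed (use F j in auto)
    have "(\<Sum>l=1..Nr - 1. f l * of_bool ((a = Failure \<and> b = Success) \<and>
         (\<forall>k\<in>{1..l}. t k = (if k = l then Success else Failure))))
        = (\<Sum>l=1..Nr - 1. if l = j then f l else 0)"
      using ab by (intro sum.cong refl) (subst iff, auto)
    also have "\<dots> = f j" using j(1) by simp
    finally have "(\<Sum>l=1..Nr - 1. f l * of_bool ((a = Failure \<and> b = Success) \<and>
         (\<forall>k\<in>{1..l}. t k = (if k = l then Success else Failure)))) = f j" .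
    moreover have "num_retransmissions Nr a b t = j"
      using ab True by (auto simp: num_retransmissions_def j_def)
    moreover have "\<not> (\<forall>k\<in>{1..Nr - 1}. t k = Failure)" using j by force
    ultimately show ?thesis using ab by simp
  qed
qed

text \<open>Relay retransmissions only add symbols, so the efficiency is at most the source rate
  \<open>R n\<close>. The sum of all rates is a bound independent of the modes; it yields
  integrability throughout.\<close>

lemma spectral_efficiency_bounded:
  assumes R: "\<And>i. i \<in> {1..N} \<Longrightarrow> R i > 0" and n: "n \<le> N" and m: "\<And>k. k \<in> {1..l} \<Longrightarrow> m k \<le> N"
  shows "\<bar>spectral_efficiency R n m l\<bar> \<le> (\<Sum>i=1..N. R i)"
proof (cases "n = 0 \<or> (\<exists>k\<in>{1..l}. m k = 0)")
  case True
  have "0 \<le> (\<Sum>i=1..N. R i)" using R by (intro sum_nonneg less_imp_le)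
  then show ?thesis using True by (auto simp: spectral_efficiency_def)
next
  case False
  then have Rn: "R n > 0" and nN: "n \<in> {1..N}" using R n by auto
  have "0 \<le> (\<Sum>k=1..l. 1 / R (m k))"
    using False R m by (intro sum_nonneg) (auto simp: Suc_le_eq intro!: less_imp_le)
  then have L: "1 / R n \<le> symbols_per_bit R n m l" by (simp add: symbols_per_bit_def)
  moreover have "0 < 1 / R n" using Rn by simp
  ultimately have pos: "0 < symbols_per_bit R n m l" by linarith
  then have "1 / symbols_per_bit R n m l \<le> R n" "0 \<le> 1 / symbols_per_bit R n m l"
    using L Rn by (auto simp: field_simps)
  moreover have "R n \<le> (\<Sum>i=1..N. R i)"
    using R nN by (intro member_le_sum) (auto intro: less_imp_le)
  ultimately show ?thesis using False by (simp only: spectral_efficiency_def if_False)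
qed

text \<open>At most one term on the right survives, the one whose indices are the actual modes. If
  some mode is 0, no term survives, in agreement with the outage convention. The gain is that each
  factor of a term involves a single mode, hence later a single SNR.\<close>

lemma spectral_efficiency_expansion:
  fixes u :: "nat \<Rightarrow> real" and v :: "nat \<Rightarrow> nat \<Rightarrow> real"
  assumes n: "n \<le> N" and m: "\<And>k. k \<in> {1..l} \<Longrightarrow> m k \<le> N"
  shows "spectral_efficiency R n m l * (u n * (\<Prod>k=1..l. v k (m k)))
    = (\<Sum>i=1..N. \<Sum>j\<in>{1..l} \<rightarrow>\<^sub>E {1..N}. 1 / symbols_per_bit R i j l *
        (of_bool (n = i) * u i * (\<Prod>k=1..l. of_bool (m k = j k) * v k (j k))))"
    (is "?lhs = (\<Sum>i=1..N. \<Sum>j\<in>?E. ?t i j)")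
proof -
  \<comment> \<open>Members of the extensional function space are \<open>undefined\<close> outside
    \<open>{1..l}\<close>, so \<open>m\<close> is restricted before it is compared with an index
    \<open>j\<close>.\<close>
  define m' where "m' = restrict m {1..l}"
  have t0: "?t i j = 0" if "n \<noteq> i \<or> m' \<noteq> j" and "j \<in> ?E" for i j
  proof (cases "n = i")
    case True
    with that have "\<exists>k\<in>{1..l}. m k \<noteq> j k"
      unfolding m'_def by (metis PiE_restrict restrict_ext)
    then have "(\<Prod>k=1..l. of_bool (m k = j k) * v k (j k)) = 0"
      by (intro prod_zero) auto
    then show ?thesis by simp
  qed simp
  have fin: "finite ?E" by (intro finite_PiE) auto
  show ?thesis
  proof (cases "n = 0 \<or> (\<exists>k\<in>{1..l}. m k = 0)")
    case True
    have "?t i j = 0" if "i \<in> {1..N}" "j \<in> ?E" for i j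
    proof (rule t0[OF _ that(2)])
      show "n \<noteq> i \<or> m' \<noteq> j" using True that by (force simp: m'_def PiE_iff)
    qed
    then have "(\<Sum>i=1..N. \<Sum>j\<in>?E. ?t i j) = 0" by (intro sum.neutral ballI)
    then show ?thesis using True by (simp only: spectral_efficiency_def) simp
  next
    case False
    then have nN: "n \<in> {1..N}" and mE: "m' \<in> ?E" using n m by (auto simp: m'_def Suc_le_eq)
    have "(\<Sum>i=1..N. \<Sum>j\<in>?E. ?t i j) = (\<Sum>j\<in>?E. ?t n j)"
    proof (rule sum.remove[OF _ nN, THEN trans])
      have "(\<Sum>i\<in>{1..N} - {n}. \<Sum>j\<in>?E. ?t i j) = 0"
        by (intro sum.neutral ballI t0) auto
      then show "(\<Sum>j\<in>?E. ?t n j) + (\<Sum>i\<in>{1..N} - {n}. \<Sum>j\<in>?E. ?t i j) = (\<Sum>j\<in>?E. ?t n j)"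
        by simp
    qed simp
    also have "\<dots> = ?t n m'"
    proof (rule sum.remove[OF fin mE, THEN trans])
      have "(\<Sum>j\<in>?E - {m'}. ?t n j) = 0"
        by (intro sum.neutral ballI t0) auto
      then show "?t n m' + (\<Sum>j\<in>?E - {m'}. ?t n j) = ?t n m'" by simp
    qed
    also have "?t n m' = 1 / symbols_per_bit R n m l * (u n * (\<Prod>k=1..l. v k (m k)))"
      by (simp add: m'_def symbols_per_bit_def)
    finally show ?thesis using False by (simp only: spectral_efficiency_def if_False)
  qed
qed

section \<open>The ARQ model\<close>

text \<open>The S-R error rate is an arbitrary \<open>[0,1]\<close>-valued function
  \<open>\<epsilon>\<close> of the source mode, to be instantiated with
  \<open>PER n \<gamma>sr\<close>. In the independence assumption, index 0 stands for the S-D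
  channel.\<close>

locale arq_model = prob_space M + source: thresholds N th1 + relay: thresholds N th2
  for M :: "'w measure" and N :: nat and th1 th2 :: "nat \<Rightarrow> ereal" +
  fixes Nr :: nat and R :: "nat \<Rightarrow> real" and p1 p2 :: "real \<Rightarrow> real"
    and PER :: "nat \<Rightarrow> real \<Rightarrow> real" and \<epsilon> :: "nat \<Rightarrow> real"
    and \<gamma>1 :: "'w \<Rightarrow> real" and \<gamma>2 :: "nat \<Rightarrow> 'w \<Rightarrow> real"
    and Tsd Tsr :: "'w \<Rightarrow> outcome" and Trd :: "nat \<Rightarrow> 'w \<Rightarrow> outcome"
  assumes R_pos: "n \<in> {1..N} \<Longrightarrow> R n > 0"
    and PER_measurable: "n \<le> N \<Longrightarrow> PER n \<in> borel_measurable (restrict_space borel {0..})"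
    and PER_01: "n \<le> N \<Longrightarrow> 0 \<le> x \<Longrightarrow> PER n x \<in> {0..1}"
    and \<epsilon>_01: "n \<le> N \<Longrightarrow> \<epsilon> n \<in> {0..1}"
    and \<gamma>1_nonneg: "\<omega> \<in> space M \<Longrightarrow> 0 \<le> \<gamma>1 \<omega>"
    and \<gamma>2_nonneg: "k \<in> {1..Nr} \<Longrightarrow> \<omega> \<in> space M \<Longrightarrow> 0 \<le> \<gamma>2 k \<omega>"
    and p1_nonneg: "0 \<le> p1 x" and p2_nonneg: "0 \<le> p2 x"
    and \<gamma>1_distributed: "distributed M lborel \<gamma>1 (\<lambda>x. ennreal (p1 x))"
    and \<gamma>2_distributed: "k \<in> {1..Nr} \<Longrightarrow> distributed M lborel (\<gamma>2 k) (\<lambda>x. ennreal (p2 x))"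
    and snr_indep: "indep_vars (\<lambda>_. borel) (\<lambda>k. if k = 0 then \<gamma>1 else \<gamma>2 k) {0..Nr}"
    and Tsd_measurable [measurable]: "Tsd \<in> measurable M (count_space UNIV)"
    and Tsr_measurable [measurable]: "Tsr \<in> measurable M (count_space UNIV)"
    and Trd_measurable: "k \<in> {1..Nr} \<Longrightarrow> Trd k \<in> measurable M (count_space UNIV)"
    and outcomes_cond_indep: "AE \<omega> in M.
           cond_prob_alg M (snr_algebra M Nr \<gamma>1 \<gamma>2)
             (\<lambda>\<omega>. Tsd \<omega> = a \<and> Tsr \<omega> = b \<and> (\<forall>k\<in>{1..Nr}. Trd k \<omega> = c k)) \<omega> =
           cond_prob_alg M (snr_algebra M Nr \<gamma>1 \<gamma>2) (\<lambda>\<omega>. Tsd \<omega> = a) \<omega> *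
           cond_prob_alg M (snr_algebra M Nr \<gamma>1 \<gamma>2) (\<lambda>\<omega>. Tsr \<omega> = b) \<omega> *
           (\<Prod>k=1..Nr. cond_prob_alg M (snr_algebra M Nr \<gamma>1 \<gamma>2) (\<lambda>\<omega>. Trd k \<omega> = c k) \<omega>)"
    and cond_prob_Tsd: "AE \<omega> in M.
           cond_prob_alg M (snr_algebra M Nr \<gamma>1 \<gamma>2) (\<lambda>\<omega>. Tsd \<omega> = Failure) \<omega> =
           PER (amc_mode N th1 (\<gamma>1 \<omega>)) (\<gamma>1 \<omega>)"
    and cond_prob_Tsr: "AE \<omega> in M.
           cond_prob_alg M (snr_algebra M Nr \<gamma>1 \<gamma>2) (\<lambda>\<omega>. Tsr \<omega> = Failure) \<omega> =
           \<epsilon> (amc_mode N th1 (\<gamma>1 \<omega>))"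
    and cond_prob_Trd: "k \<in> {1..Nr} \<Longrightarrow> AE \<omega> in M.
           cond_prob_alg M (snr_algebra M Nr \<gamma>1 \<gamma>2) (\<lambda>\<omega>. Trd k \<omega> = Failure) \<omega> =
           PER (amc_mode N th2 (\<gamma>2 k \<omega>)) (\<gamma>2 k \<omega>)"
begin

definition source_mode :: "'w \<Rightarrow> nat" where
  "source_mode \<omega> = amc_mode N th1 (\<gamma>1 \<omega>)"

definition relay_mode :: "'w \<Rightarrow> nat \<Rightarrow> nat" where
  "relay_mode \<omega> k = amc_mode N th2 (\<gamma>2 k \<omega>)"

text \<open>Conditional probability of outcome \<open>a\<close> in a retransmission with mode
  \<open>n\<close> at SNR \<open>x\<close>. Having the outcome as an argument turns outcome patterns
  uniformly into products.\<close>

definition relay_prob :: "outcome \<Rightarrow> nat \<Rightarrow> real \<Rightarrow> real" where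
  "relay_prob a n x = (if a = Success then 1 - PER n x else PER n x)"

text \<open>Conditional probability that the relay has to retransmit, that is, D fails and R
  decodes.\<close>

definition forward_prob :: "nat \<Rightarrow> real \<Rightarrow> real" where
  "forward_prob n x = (1 - \<epsilon> n) * PER n x"

abbreviation "\<F> \<equiv> snr_algebra M Nr \<gamma>1 \<gamma>2"

section \<open>Modes and efficiency as functions of the SNRs\<close>

lemma source_mode_le: "\<omega> \<in> space M \<Longrightarrow> source_mode \<omega> \<le> N"
  unfolding source_mode_def by (rule source.amc_mode_le[OF \<gamma>1_nonneg])

lemma relay_mode_le: "k \<in> {1..Nr} \<Longrightarrow> \<omega> \<in> space M \<Longrightarrow> relay_mode \<omega> k \<le> N"
  unfolding relay_mode_def by (rule relay.amc_mode_le[OF \<gamma>2_nonneg])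

lemma \<gamma>1_measurable [measurable]: "\<gamma>1 \<in> borel_measurable M"
  using distributed_measurable[OF \<gamma>1_distributed] by simp

lemma \<gamma>2_measurable: "k \<in> {1..Nr} \<Longrightarrow> \<gamma>2 k \<in> borel_measurable M"
  using distributed_measurable[OF \<gamma>2_distributed] by simp

lemma snr_algebra:
  shows subalgebra_snr: "subalgebra M \<F>"
    and \<gamma>1_measurable_snr: "\<gamma>1 \<in> borel_measurable \<F>"
    and \<gamma>2_measurable_snr: "k \<in> {1..Nr} \<Longrightarrow> \<gamma>2 k \<in> borel_measurable \<F>"
proof -
  let ?P = "borel \<Otimes>\<^sub>M (\<Pi>\<^sub>M k\<in>{1..Nr}. borel) :: (real \<times> (nat \<Rightarrow> real)) measure"
  let ?g = "\<lambda>\<omega>. (\<gamma>1 \<omega>, \<lambda>k\<in>{1..Nr}. \<gamma>2 k \<omega>)"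
  have g: "?g \<in> measurable M ?P"
    using \<gamma>2_measurable by (intro measurable_Pair measurable_restrict) auto
  show "subalgebra M \<F>"
    unfolding subalgebra_def snr_algebra_def
    using sets_image_in_sets[OF refl g] by simp
  have gF: "?g \<in> measurable \<F> ?P"
    unfolding snr_algebra_def using measurable_space[OF g]
    by (intro measurable_vimage_algebra1) auto
  from measurable_compose[OF gF measurable_fst] show "\<gamma>1 \<in> borel_measurable \<F>" by simp
  assume k: "k \<in> {1..Nr}"
  then have "(\<lambda>x. snd x k) \<in> borel_measurable ?P"
    by (intro measurable_compose[OF measurable_snd measurable_component_singleton])
  from measurable_compose[OF gF this] show "\<gamma>2 k \<in> borel_measurable \<F>" using k by simp
qed

lemma space_snr: "space \<F> = space M"
  using subalgebra_snr by (simp add: subalgebra_def)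

text \<open>Measurability over the SNR algebra, not merely over \<open>M\<close>, is what allows the
  efficiency to act as a weight under conditioning. The bound on \<open>l\<close> keeps all
  occurring SNRs among the generators.\<close>

lemma spectral_efficiency_measurable:
  assumes l: "l \<le> Nr"
  shows "(\<lambda>\<omega>. spectral_efficiency R (source_mode \<omega>) (relay_mode \<omega>) l) \<in> borel_measurable \<F>"
proof -
  have n [measurable]: "source_mode \<in> measurable \<F> (count_space UNIV)"
    unfolding source_mode_def[abs_def]
    by (rule source.measurable_amc_mode[OF \<gamma>1_measurable_snr]) (simp add: space_snr \<gamma>1_nonneg)
  have m [measurable]: "(\<lambda>\<omega>. relay_mode \<omega> k) \<in> measurable \<F> (count_space UNIV)" if "k \<in> {1..l}" for k
    unfolding relay_mode_def
    by (rule relay.measurable_amc_mode[OF \<gamma>2_measurable_snr])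
       (use that l in \<open>auto simp: space_snr \<gamma>2_nonneg\<close>)
  have R [measurable]: "R \<in> borel_measurable (count_space UNIV)" by simp
  have [measurable]: "(\<lambda>\<omega>. R (relay_mode \<omega> k)) \<in> borel_measurable \<F>" if "k \<in> {1..l}" for k
    using measurable_compose[OF m[OF that] R] .
  show ?thesis
    unfolding spectral_efficiency_def symbols_per_bit_def by measurable
qed

lemma spectral_efficiency_le:
  "l \<le> Nr \<Longrightarrow> \<omega> \<in> space M \<Longrightarrow> \<bar>spectral_efficiency R (source_mode \<omega>) (relay_mode \<omega>) l\<bar> \<le> (\<Sum>i=1..N. R i)"
  by (intro spectral_efficiency_bounded R_pos source_mode_le relay_mode_le) auto

lemma relay_prob_measurable:
  "n \<le> N \<Longrightarrow> relay_prob a n \<in> borel_measurable (restrict_space borel {0..})"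
  unfolding relay_prob_def[abs_def] using PER_measurable[of n] by (cases a) auto

lemma relay_prob_01: "n \<le> N \<Longrightarrow> 0 \<le> x \<Longrightarrow> relay_prob a n x \<in> {0..1}"
  using PER_01[of n x] by (auto simp: relay_prob_def)

lemma forward_prob_measurable:
  "n \<le> N \<Longrightarrow> forward_prob n \<in> borel_measurable (restrict_space borel {0..})"
  unfolding forward_prob_def[abs_def] using PER_measurable[of n] by auto

lemma forward_prob_01: "n \<le> N \<Longrightarrow> 0 \<le> x \<Longrightarrow> forward_prob n x \<in> {0..1}"
  using PER_01[of n x] \<epsilon>_01[of n] by (auto simp: forward_prob_def intro: mult_le_one)

text \<open>The weights \<open>u\<close> and \<open>v\<close> are left general, and \<open>v\<close>
  may vary with \<open>k\<close>, so that one computation covers zero retransmissions, a success at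
  \<open>l\<close>, and the last retransmission with its open outcome.\<close>

lemma snr_expectation:
  assumes l: "l \<le> Nr"
    and u: "\<And>n. n \<le> N \<Longrightarrow> u n \<in> borel_measurable (restrict_space borel {0..})"
    and u1: "\<And>n x. n \<le> N \<Longrightarrow> 0 \<le> x \<Longrightarrow> u n x \<in> {0..1}"
    and v: "\<And>k n. n \<le> N \<Longrightarrow> v k n \<in> borel_measurable (restrict_space borel {0..})"
    and v1: "\<And>k n x. n \<le> N \<Longrightarrow> 0 \<le> x \<Longrightarrow> v k n x \<in> {0..1}"
  shows "(LINT \<omega>|M. spectral_efficiency R (source_mode \<omega>) (relay_mode \<omega>) l *
            (u (source_mode \<omega>) (\<gamma>1 \<omega>) * (\<Prod>k=1..l. v k (relay_mode \<omega> k) (\<gamma>2 k \<omega>))))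
    = (\<Sum>i=1..N. \<Sum>j\<in>{1..l} \<rightarrow>\<^sub>E {1..N}. 1 / symbols_per_bit R i j l *
         ((LBINT x=th1 i..th1 (Suc i). u i x * p1 x) *
          (\<Prod>k=1..l. LBINT x=th2 (j k)..th2 (Suc (j k)). v k (j k) x * p2 x)))"
proof -
  \<comment> \<open>One family indexed by \<open>0..l\<close>, matching the indexing of the
    independence assumption. The cell indicators are built in so that every member is Borel on the
    whole line.\<close>
  define Y :: "nat \<Rightarrow> (nat \<Rightarrow> nat) \<Rightarrow> nat \<Rightarrow> real \<Rightarrow> real" where
    "Y i j k x = (if k = 0 then indicator (mode_cell th1 i) x * u i x
       else indicator (mode_cell th2 (j k)) x * v k (j k) x)" for i j k x
  let ?X = "\<lambda>k. if k = 0 then \<gamma>1 else \<gamma>2 k"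
  have bounds: "i \<le> N" "k \<in> {1..l} \<Longrightarrow> j k \<le> N"
    if "i \<in> {1..N}" "j \<in> {1..l} \<rightarrow>\<^sub>E {1..N}" for i j k
    using that PiE_mem[OF that(2), of k] by auto
  have cell_prod: "(LINT \<omega>|M. (\<Prod>k\<in>{0..l}. Y i j k (?X k \<omega>)))
      = (LBINT x=th1 i..th1 (Suc i). u i x * p1 x) *
          (\<Prod>k=1..l. LBINT x=th2 (j k)..th2 (Suc (j k)). v k (j k) x * p2 x)"
    and cell_prod_int: "integrable M (\<lambda>\<omega>. \<Prod>k\<in>{0..l}. Y i j k (?X k \<omega>))"
    if ij: "i \<in> {1..N}" "j \<in> {1..l} \<rightarrow>\<^sub>E {1..N}" for i j
  proof -
    note b = bounds[OF ij]
    have Ym: "Y i j k \<in> borel_measurable borel" if "k \<in> {0..l}" for k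
      using that b source.borel_measurable_mode_cell[OF u] relay.borel_measurable_mode_cell[OF v]
      by (cases "k = 0") (auto simp: Y_def[abs_def])
    have Xm: "?X k \<in> borel_measurable M" if "k \<in> {0..l}" for k
      using that l \<gamma>1_measurable \<gamma>2_measurable by auto
    have indep: "indep_vars (\<lambda>_. borel) (\<lambda>k \<omega>. Y i j k (?X k \<omega>)) {0..l}"
      by (rule indep_vars_compose2[OF indep_vars_subset[OF snr_indep]]) (use l Ym in auto)
    have int: "integrable M (\<lambda>\<omega>. Y i j k (?X k \<omega>))" if k: "k \<in> {0..l}" for k
    proof (rule integrable_const_bound[where B=1])
      show "(\<lambda>\<omega>. Y i j k (?X k \<omega>)) \<in> borel_measurable M"
        by (rule measurable_compose[OF Xm[OF k] Ym[OF k]])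
      have "\<bar>Y i j k (?X k \<omega>)\<bar> \<le> 1" if "\<omega> \<in> space M" for \<omega>
        using u1[OF b(1) \<gamma>1_nonneg[OF that]] v1[OF b(2) \<gamma>2_nonneg[OF _ that], of k k] k l
        by (auto simp: Y_def indicator_def)
      then show "AE \<omega> in M. norm (Y i j k (?X k \<omega>)) \<le> 1" by auto
    qed
    show "integrable M (\<lambda>\<omega>. \<Prod>k\<in>{0..l}. Y i j k (?X k \<omega>))"
      by (rule indep_vars_integrable[OF _ indep int]) auto
    have "(LINT \<omega>|M. (\<Prod>k\<in>{0..l}. Y i j k (?X k \<omega>))) = (\<Prod>k\<in>{0..l}. LINT \<omega>|M. Y i j k (?X k \<omega>))"
      by (rule indep_vars_lebesgue_integral[OF _ indep int]) auto
    also have "\<dots> = (LINT \<omega>|M. Y i j 0 (\<gamma>1 \<omega>)) * (\<Prod>k=1..l. LINT \<omega>|M. Y i j k (\<gamma>2 k \<omega>))"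
      by (subst prod.atLeast_Suc_atMost) auto
    also have "(LINT \<omega>|M. Y i j 0 (\<gamma>1 \<omega>)) = (LBINT x=th1 i..th1 (Suc i). u i x * p1 x)"
      unfolding Y_def using source.integral_mode_cell[OF \<gamma>1_distributed p1_nonneg u[OF b(1)] b(1)]
      by simp
    also have "(\<Prod>k=1..l. LINT \<omega>|M. Y i j k (\<gamma>2 k \<omega>))
        = (\<Prod>k=1..l. LBINT x=th2 (j k)..th2 (Suc (j k)). v k (j k) x * p2 x)"
    proof (rule prod.cong[OF refl])
      fix k assume k: "k \<in> {1..l}"
      then have "k \<in> {1..Nr}" using l by auto
      from relay.integral_mode_cell[OF \<gamma>2_distributed[OF this] p2_nonneg v[OF b(2)[OF k]] b(2)[OF k]]
      show "(LINT \<omega>|M. Y i j k (\<gamma>2 k \<omega>)) = (LBINT x=th2 (j k)..th2 (Suc (j k)). v k (j k) x * p2 x)"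
        using k by (simp add: Y_def)
    qed
    finally show "(LINT \<omega>|M. (\<Prod>k\<in>{0..l}. Y i j k (?X k \<omega>)))
      = (LBINT x=th1 i..th1 (Suc i). u i x * p1 x) *
          (\<Prod>k=1..l. LBINT x=th2 (j k)..th2 (Suc (j k)). v k (j k) x * p2 x)" .
  qed
  have "(LINT \<omega>|M. spectral_efficiency R (source_mode \<omega>) (relay_mode \<omega>) l *
            (u (source_mode \<omega>) (\<gamma>1 \<omega>) * (\<Prod>k=1..l. v k (relay_mode \<omega> k) (\<gamma>2 k \<omega>))))
     = (LINT \<omega>|M. (\<Sum>i=1..N. \<Sum>j\<in>{1..l} \<rightarrow>\<^sub>E {1..N}. 1 / symbols_per_bit R i j l *
         (\<Prod>k\<in>{0..l}. Y i j k (?X k \<omega>))))"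
  proof (rule Bochner_Integration.integral_cong[OF refl])
    fix \<omega> assume \<omega>: "\<omega> \<in> space M"
    have m: "relay_mode \<omega> k \<le> N" if "k \<in> {1..l}" for k using relay_mode_le[OF _ \<omega>] that l by auto
    \<comment> \<open>At nonnegative SNRs, testing for a mode is the same as evaluating the
      indicator of its cell; this turns the terms of the expansion into products of the
      \<open>Y\<close>.\<close>
    have "of_bool (source_mode \<omega> = i) * u i (\<gamma>1 \<omega>) * (\<Prod>k=1..l. of_bool (relay_mode \<omega> k = j k) * v k (j k) (\<gamma>2 k \<omega>))
        = (\<Prod>k\<in>{0..l}. Y i j k (?X k \<omega>))"
      if ij: "i \<in> {1..N}" "j \<in> {1..l} \<rightarrow>\<^sub>E {1..N}" for i j
    proof -
      note b = bounds[OF ij]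
      have "of_bool (source_mode \<omega> = i) * u i (\<gamma>1 \<omega>) = Y i j 0 (\<gamma>1 \<omega>)"
        using source.amc_mode_eq_iff[OF \<gamma>1_nonneg[OF \<omega>] b(1)]
        by (simp add: Y_def source_mode_def indicator_def)
      moreover have "(\<Prod>k=1..l. of_bool (relay_mode \<omega> k = j k) * v k (j k) (\<gamma>2 k \<omega>))
          = (\<Prod>k=1..l. Y i j k (\<gamma>2 k \<omega>))"
      proof (rule prod.cong[OF refl])
        fix k assume k: "k \<in> {1..l}"
        then have "k \<in> {1..Nr}" using l by auto
        from relay.amc_mode_eq_iff[OF \<gamma>2_nonneg[OF this \<omega>] b(2)[OF k]]
        show "of_bool (relay_mode \<omega> k = j k) * v k (j k) (\<gamma>2 k \<omega>) = Y i j k (\<gamma>2 k \<omega>)"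
          using k by (simp add: Y_def relay_mode_def indicator_def)
      qed
      moreover have "(\<Prod>k\<in>{0..l}. Y i j k (?X k \<omega>)) = Y i j 0 (\<gamma>1 \<omega>) * (\<Prod>k=1..l. Y i j k (\<gamma>2 k \<omega>))"
        by (subst prod.atLeast_Suc_atMost) auto
      ultimately show ?thesis by simp
    qed
    then show "spectral_efficiency R (source_mode \<omega>) (relay_mode \<omega>) l *
            (u (source_mode \<omega>) (\<gamma>1 \<omega>) * (\<Prod>k=1..l. v k (relay_mode \<omega> k) (\<gamma>2 k \<omega>)))
       = (\<Sum>i=1..N. \<Sum>j\<in>{1..l} \<rightarrow>\<^sub>E {1..N}. 1 / symbols_per_bit R i j l *
         (\<Prod>k\<in>{0..l}. Y i j k (?X k \<omega>)))"
      using spectral_efficiency_expansion[OF source_mode_le[OF \<omega>] m, where u="\<lambda>i. u i (\<gamma>1 \<omega>)"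
          and v="\<lambda>k i. v k i (\<gamma>2 k \<omega>)" and R=R]
      by (simp only: cong: sum.cong)
  qed
  also have "\<dots> = (\<Sum>i=1..N. LINT \<omega>|M. (\<Sum>j\<in>{1..l} \<rightarrow>\<^sub>E {1..N}. 1 / symbols_per_bit R i j l *
         (\<Prod>k\<in>{0..l}. Y i j k (?X k \<omega>))))"
    by (intro Bochner_Integration.integral_sum Bochner_Integration.integrable_sum
        integrable_mult_right cell_prod_int)
  also have "\<dots> = (\<Sum>i=1..N. \<Sum>j\<in>{1..l} \<rightarrow>\<^sub>E {1..N}. LINT \<omega>|M. 1 / symbols_per_bit R i j l *
         (\<Prod>k\<in>{0..l}. Y i j k (?X k \<omega>)))"
    by (intro sum.cong refl Bochner_Integration.integral_sum integrable_mult_right cell_prod_int)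
  also have "\<dots> = (\<Sum>i=1..N. \<Sum>j\<in>{1..l} \<rightarrow>\<^sub>E {1..N}. 1 / symbols_per_bit R i j l *
         ((LBINT x=th1 i..th1 (Suc i). u i x * p1 x) *
          (\<Prod>k=1..l. LBINT x=th2 (j k)..th2 (Suc (j k)). v k (j k) x * p2 x)))"
    by (intro sum.cong refl) (simp only: integral_mult_right_zero cell_prod)
  finally show ?thesis .
qed

section \<open>Outcome events given the SNRs\<close>

lemma outcome_event:
  assumes K: "K \<subseteq> {1..Nr}"
  shows "{\<omega> \<in> space M. (Tsd \<omega> = Failure \<and> Tsr \<omega> = Success) \<and> (\<forall>k\<in>K. Trd k \<omega> = c k)} \<in> sets M"
proof -
  have [measurable]: "Trd k \<in> measurable M (count_space UNIV)" if "k \<in> K" for k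
    using that K Trd_measurable by auto
  have [simp]: "finite K" using K by (rule finite_subset) simp
  show ?thesis by measurable
qed

lemma outcome_integrable:
  fixes h :: "'w \<Rightarrow> real"
  assumes h: "h \<in> borel_measurable \<F>" and hB: "\<And>\<omega>. \<omega> \<in> space M \<Longrightarrow> \<bar>h \<omega>\<bar> \<le> B"
    and K: "K \<subseteq> {1..Nr}"
  shows "integrable M (\<lambda>\<omega>. h \<omega> *
    of_bool ((Tsd \<omega> = Failure \<and> Tsr \<omega> = Success) \<and> (\<forall>k\<in>K. Trd k \<omega> = c k)))"
  using outcome_event[OF K, of c]
  by (intro integrable_mult_01[OF measurable_from_subalg[OF subalgebra_snr h] hB]) auto

text \<open>Since \<open>h\<close> depends on the SNRs only, the outcome indicator can be replaced
  by its conditional probability. Conditional independence provides this for patterns on all of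
  \<open>{1..Nr}\<close>, and \<open>marginal_integral\<close> passes to \<open>J\<close>.\<close>

lemma outcome_expectation:
  assumes h: "h \<in> borel_measurable \<F>" and hB: "\<And>\<omega>. \<omega> \<in> space M \<Longrightarrow> \<bar>h \<omega>\<bar> \<le> B"
    and J: "J \<subseteq> {1..Nr}"
  shows "(LINT \<omega>|M. h \<omega> * of_bool ((Tsd \<omega> = Failure \<and> Tsr \<omega> = Success) \<and> (\<forall>k\<in>J. Trd k \<omega> = c k)))
    = (LINT \<omega>|M. h \<omega> * (forward_prob (source_mode \<omega>) (\<gamma>1 \<omega>) *
         (\<Prod>k\<in>J. relay_prob (c k) (relay_mode \<omega> k) (\<gamma>2 k \<omega>))))"
proof -
  have hM [measurable]: "h \<in> borel_measurable M"
    by (rule measurable_from_subalg[OF subalgebra_snr h])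
  have w [measurable]: "(\<lambda>\<omega>. forward_prob (source_mode \<omega>) (\<gamma>1 \<omega>)) \<in> borel_measurable M"
    unfolding source_mode_def
    by (rule source.measurable_at_amc_mode[OF \<gamma>1_measurable \<gamma>1_nonneg forward_prob_measurable])
  have q [measurable]: "(\<lambda>\<omega>. relay_prob a (relay_mode \<omega> k) (\<gamma>2 k \<omega>)) \<in> borel_measurable M"
    if "k \<in> {1..Nr}" for a k
    unfolding relay_mode_def
    by (rule relay.measurable_at_amc_mode[OF \<gamma>2_measurable[OF that] \<gamma>2_nonneg[OF that] relay_prob_measurable])
  have prod_m: "(\<lambda>\<omega>. \<Prod>k\<in>K. relay_prob (c k) (relay_mode \<omega> k) (\<gamma>2 k \<omega>)) \<in> borel_measurable M"
    if "K \<subseteq> {1..Nr}" for K c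
    using that by (intro borel_measurable_prod q) auto
  show ?thesis
  proof (rule marginal_integral[where I="{1..Nr}" and q="\<lambda>k a \<omega>. relay_prob a (relay_mode \<omega> k) (\<gamma>2 k \<omega>)",
        OF _ J])
    fix c :: "nat \<Rightarrow> outcome"
    have rd: "AE \<omega> in M. \<forall>k\<in>{1..Nr}. cond_prob_alg M \<F> (\<lambda>\<omega>. Trd k \<omega> = c k) \<omega>
        = relay_prob (c k) (relay_mode \<omega> k) (\<gamma>2 k \<omega>)"
    proof (rule AE_finite_allI)
      fix k assume k: "k \<in> {1..Nr}"
      show "AE \<omega> in M. cond_prob_alg M \<F> (\<lambda>\<omega>. Trd k \<omega> = c k) \<omega>
        = relay_prob (c k) (relay_mode \<omega> k) (\<gamma>2 k \<omega>)"
        using cond_prob_Trd[OF k] cond_prob_Success[OF subalgebra_snr Trd_measurable[OF k] cond_prob_Trd[OF k]]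
        by (cases "c k") (simp_all add: relay_prob_def relay_mode_def)
    qed simp
    have "AE \<omega> in M. cond_prob_alg M \<F> (\<lambda>\<omega>. (Tsd \<omega> = Failure \<and> Tsr \<omega> = Success) \<and>
        (\<forall>k\<in>{1..Nr}. Trd k \<omega> = c k)) \<omega>
      = forward_prob (source_mode \<omega>) (\<gamma>1 \<omega>) * (\<Prod>k\<in>{1..Nr}. relay_prob (c k) (relay_mode \<omega> k) (\<gamma>2 k \<omega>))"
      using outcomes_cond_indep[of Failure Success c] cond_prob_Tsd
        cond_prob_Success[OF subalgebra_snr Tsr_measurable cond_prob_Tsr] rd
      by eventually_elim (simp add: forward_prob_def source_mode_def mult.commute)
    then show "(LINT \<omega>|M. h \<omega> * of_bool ((Tsd \<omega> = Failure \<and> Tsr \<omega> = Success) \<and> (\<forall>k\<in>{1..Nr}. Trd k \<omega> = c k)))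
      = (LINT \<omega>|M. h \<omega> * (forward_prob (source_mode \<omega>) (\<gamma>1 \<omega>) *
         (\<Prod>k\<in>{1..Nr}. relay_prob (c k) (relay_mode \<omega> k) (\<gamma>2 k \<omega>))))"
      by (intro integral_mult_cond_prob[OF subalgebra_snr outcome_event h hB] borel_measurable_times w prod_m) auto
  next
    fix K c assume K: "K \<subseteq> {1..Nr}"
    show "integrable M (\<lambda>\<omega>. h \<omega> * of_bool ((Tsd \<omega> = Failure \<and> Tsr \<omega> = Success) \<and> (\<forall>k\<in>K. Trd k \<omega> = c k)))"
      by (rule outcome_integrable[OF h hB K])
    show "integrable M (\<lambda>\<omega>. h \<omega> * (forward_prob (source_mode \<omega>) (\<gamma>1 \<omega>) *
         (\<Prod>k\<in>K. relay_prob (c k) (relay_mode \<omega> k) (\<gamma>2 k \<omega>))))"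
    proof (rule integrable_mult_01[OF hM hB])
      fix \<omega> assume \<omega>: "\<omega> \<in> space M"
      have "relay_prob (c k) (relay_mode \<omega> k) (\<gamma>2 k \<omega>) \<in> {0..1}" if "k \<in> K" for k
        using that K by (intro relay_prob_01 relay_mode_le \<gamma>2_nonneg \<omega>) auto
      then have "(\<Prod>k\<in>K. relay_prob (c k) (relay_mode \<omega> k) (\<gamma>2 k \<omega>)) \<in> {0..1}"
        by (auto intro!: prod_nonneg prod_le_1)
      with forward_prob_01[OF source_mode_le[OF \<omega>] \<gamma>1_nonneg[OF \<omega>]]
      show "forward_prob (source_mode \<omega>) (\<gamma>1 \<omega>) * (\<Prod>k\<in>K. relay_prob (c k) (relay_mode \<omega> k) (\<gamma>2 k \<omega>)) \<in> {0..1}"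
        by (auto intro: mult_le_one)
    qed (assumption | intro borel_measurable_times w prod_m K)+
  qed (auto simp: relay_prob_def)
qed

lemma avg_spectral_efficiency_formula:
  assumes Nr: "1 \<le> Nr"
    and mp1: "\<And>n. n \<in> {1..N} \<Longrightarrow> mode_prob th1 p1 n > 0"
    and mp2: "\<And>m. m \<in> {1..N} \<Longrightarrow> mode_prob th2 p2 m > 0"
  shows "avg_spectral_efficiency M N Nr R th1 th2 \<gamma>1 \<gamma>2 Tsd Tsr Trd =
      (\<Sum>n=1..N. (1 - (1 - \<epsilon> n) * avg_PER PER th1 p1 n) / symbols_per_bit R n (\<lambda>_. 0) 0
                   * mode_prob th1 p1 n)
    + (\<Sum>l=1..Nr - 1. \<Sum>n=1..N. \<Sum>m\<in>{1..l} \<rightarrow>\<^sub>E {1..N}.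
         (1 - \<epsilon> n) / symbols_per_bit R n m l * avg_PER PER th1 p1 n * mode_prob th1 p1 n
         * (\<Prod>k=1..l - 1. avg_PER PER th2 p2 (m k) * mode_prob th2 p2 (m k))
         * (1 - avg_PER PER th2 p2 (m l)) * mode_prob th2 p2 (m l))
    + (\<Sum>n=1..N. \<Sum>m\<in>{1..Nr} \<rightarrow>\<^sub>E {1..N}.
         (1 - \<epsilon> n) * avg_PER PER th1 p1 n * mode_prob th1 p1 n * mode_prob th2 p2 (m Nr)
           / symbols_per_bit R n m Nr
         * (\<Prod>k=1..Nr - 1. avg_PER PER th2 p2 (m k) * mode_prob th2 p2 (m k)))"
    (is "_ = ?A + ?B + ?C")
proof -
  define S where "S l \<omega> = spectral_efficiency R (source_mode \<omega>) (relay_mode \<omega>) l" for l \<omega>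
  define E where "E K c \<omega> \<longleftrightarrow> (Tsd \<omega> = Failure \<and> Tsr \<omega> = Success) \<and> (\<forall>k\<in>K. Trd k \<omega> = c k)"
    for K c \<omega>
  let ?c = "\<lambda>l k. if k = l then Success else Failure"
  let ?a = "\<lambda>n. avg_PER PER th1 p1 n * mode_prob th1 p1 n"
  let ?b = "\<lambda>m. avg_PER PER th2 p2 m * mode_prob th2 p2 m"
  have S_meas: "S l \<in> borel_measurable \<F>" if "l \<le> Nr" for l
    unfolding S_def[abs_def] by (rule spectral_efficiency_measurable[OF that])
  have S_le: "\<bar>S l \<omega>\<bar> \<le> (\<Sum>i=1..N. R i)" if "l \<le> Nr" "\<omega> \<in> space M" for l \<omega>
    unfolding S_def by (rule spectral_efficiency_le[OF that])
  have S_int: "integrable M (S l)" if "l \<le> Nr" for l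
    using measurable_from_subalg[OF subalgebra_snr S_meas[OF that]] S_le[OF that]
    by (intro integrable_const_bound[where B="\<Sum>i=1..N. R i"]) auto
  have SE_int: "integrable M (\<lambda>\<omega>. S l \<omega> * of_bool (E K c \<omega>))"
    if "l \<le> Nr" "K \<subseteq> {1..Nr}" for l K c
    unfolding E_def by (rule outcome_integrable[OF S_meas[OF that(1)] S_le[OF that(1)] that(2)])
  have SE_eq: "(LINT \<omega>|M. S l \<omega> * of_bool (E K c \<omega>))
      = (LINT \<omega>|M. S l \<omega> * (forward_prob (source_mode \<omega>) (\<gamma>1 \<omega>) *
          (\<Prod>k\<in>K. relay_prob (c k) (relay_mode \<omega> k) (\<gamma>2 k \<omega>))))"
    if "l \<le> Nr" "K \<subseteq> {1..Nr}" for l K c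
    unfolding E_def by (rule outcome_expectation[OF S_meas[OF that(1)] S_le[OF that(1)] that(2)])
  note snr_exp = snr_expectation[folded S_def]
  have fwd: "(LBINT x=th1 i..th1 (Suc i). forward_prob i x * p1 x) = (1 - \<epsilon> i) * ?a i"
    if "i \<in> {1..N}" for i
    using avg_PER_mult_mode_prob[of th1 p1 i PER] mp1[OF that]
    by (simp add: forward_prob_def mult.assoc)
  have fail: "(LBINT x=th2 j..th2 (Suc j). relay_prob Failure j x * p2 x) = ?b j"
    if "j \<in> {1..N}" for j
    using avg_PER_mult_mode_prob[of th2 p2 j PER] mp2[OF that] by (simp add: relay_prob_def)
  have succ: "(LBINT x=th2 j..th2 (Suc j). relay_prob Success j x * p2 x)
      = (1 - avg_PER PER th2 p2 j) * mode_prob th2 p2 j" if j: "j \<in> {1..N}" for j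
  proof -
    \<comment> \<open>All relay SNRs share the density \<open>p2\<close>; the first one, available
      because \<open>Nr \<ge> 1\<close>, serves as the random variable behind it.\<close>
    have "1 \<in> {1..Nr}" "j \<le> N" using Nr j by auto
    from relay.interval_integral_one_minus[OF prob_space_axioms \<gamma>2_distributed[OF this(1)] p2_nonneg
        PER_measurable[OF this(2)] PER_01[OF this(2)] this(2)]
    show ?thesis
      using avg_PER_mult_mode_prob[of th2 p2 j PER] mp2[OF j]
      by (simp add: relay_prob_def left_diff_distrib)
  qed
  \<comment> \<open>The final retransmission differs from the preceding failures, so its factor is
    separated; this accounts for the products up to \<open>l - 1\<close> in the formula.\<close>
  have split_last: "(\<Prod>k=1..l. if k = l then x k else y k) = (\<Prod>k=1..l - 1. y k) * x l"
    if "1 \<le> l" for l :: nat and x y :: "nat \<Rightarrow> real"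
  proof -
    have "{1..l} = insert l {1..l - 1}" "l \<notin> {1..l - 1}" using that by auto
    moreover have "(\<Prod>k=1..l - 1. if k = l then x k else y k) = (\<Prod>k=1..l - 1. y k)"
      using that by (intro prod.cong) auto
    ultimately show ?thesis by simp
  qed
  have "avg_spectral_efficiency M N Nr R th1 th2 \<gamma>1 \<gamma>2 Tsd Tsr Trd
     = (LINT \<omega>|M. S 0 \<omega> - S 0 \<omega> * of_bool (E {} (\<lambda>_. Failure) \<omega>)
         + (\<Sum>l=1..Nr - 1. S l \<omega> * of_bool (E {1..l} (?c l) \<omega>))
         + S Nr \<omega> * of_bool (E {1..Nr - 1} (\<lambda>_. Failure) \<omega>))"
    unfolding avg_spectral_efficiency_def
  proof (rule Bochner_Integration.integral_cong[OF refl])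
    fix \<omega>
    have E0: "E {} c \<omega> \<longleftrightarrow> Tsd \<omega> = Failure \<and> Tsr \<omega> = Success" for c
      by (simp add: E_def)
    have "spectral_efficiency R (amc_mode N th1 (\<gamma>1 \<omega>)) (\<lambda>k. amc_mode N th2 (\<gamma>2 k \<omega>)) l = S l \<omega>" for l
      by (simp add: S_def source_mode_def relay_mode_def[abs_def])
    then show "spectral_efficiency R (amc_mode N th1 (\<gamma>1 \<omega>)) (\<lambda>k. amc_mode N th2 (\<gamma>2 k \<omega>))
        (num_retransmissions Nr (Tsd \<omega>) (Tsr \<omega>) (\<lambda>k. Trd k \<omega>))
      = S 0 \<omega> - S 0 \<omega> * of_bool (E {} (\<lambda>_. Failure) \<omega>)
         + (\<Sum>l=1..Nr - 1. S l \<omega> * of_bool (E {1..l} (?c l) \<omega>))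
         + S Nr \<omega> * of_bool (E {1..Nr - 1} (\<lambda>_. Failure) \<omega>)"
      using num_retransmissions_split[OF Nr, of "\<lambda>l. S l \<omega>" "Tsd \<omega>" "Tsr \<omega>" "\<lambda>k. Trd k \<omega>"]
      by (simp only: E0) (simp only: E_def)
  qed
  also have "\<dots> = ((LINT \<omega>|M. S 0 \<omega>) - (LINT \<omega>|M. S 0 \<omega> * of_bool (E {} (\<lambda>_. Failure) \<omega>)))
      + (\<Sum>l=1..Nr - 1. LINT \<omega>|M. S l \<omega> * of_bool (E {1..l} (?c l) \<omega>))
      + (LINT \<omega>|M. S Nr \<omega> * of_bool (E {1..Nr - 1} (\<lambda>_. Failure) \<omega>))"
  proof -
    have 0: "integrable M (S 0)" "integrable M (\<lambda>\<omega>. S 0 \<omega> * of_bool (E {} (\<lambda>_. Failure) \<omega>))"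
      by (auto intro: S_int SE_int)
    have l: "integrable M (\<lambda>\<omega>. S l \<omega> * of_bool (E {1..l} (?c l) \<omega>))" if "l \<in> {1..Nr - 1}" for l
      using that by (intro SE_int) auto
    have Nr: "integrable M (\<lambda>\<omega>. S Nr \<omega> * of_bool (E {1..Nr - 1} (\<lambda>_. Failure) \<omega>))"
      by (intro SE_int) auto
    note d = Bochner_Integration.integrable_diff[OF 0]
    have s: "integrable M (\<lambda>\<omega>. \<Sum>l=1..Nr - 1. S l \<omega> * of_bool (E {1..l} (?c l) \<omega>))"
      by (intro Bochner_Integration.integrable_sum l)
    show ?thesis
      by (simp only: Bochner_Integration.integral_add[OF Bochner_Integration.integrable_add[OF d s] Nr]
          Bochner_Integration.integral_add[OF d s] Bochner_Integration.integral_diff[OF 0]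
          Bochner_Integration.integral_sum[OF l])
  qed
  also have "(LINT \<omega>|M. S 0 \<omega>) - (LINT \<omega>|M. S 0 \<omega> * of_bool (E {} (\<lambda>_. Failure) \<omega>)) = ?A"
  proof -
    \<comment> \<open>For \<open>l = 0\<close> the index set of relay modes has exactly one element
      and the relay product is empty, so only the sum over source modes remains.\<close>
    have "(LINT \<omega>|M. S 0 \<omega>) = (\<Sum>i=1..N. 1 / symbols_per_bit R i (\<lambda>_. 0) 0 * mode_prob th1 p1 i)"
      using snr_exp[of 0 "\<lambda>_ _. 1" "\<lambda>_ _ _. 1"] by (simp add: symbols_per_bit_def mode_prob_def)
    moreover have "(LINT \<omega>|M. S 0 \<omega> * of_bool (E {} (\<lambda>_. Failure) \<omega>))
        = (\<Sum>i=1..N. 1 / symbols_per_bit R i (\<lambda>_. 0) 0 * ((1 - \<epsilon> i) * ?a i))"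
      using snr_exp[of 0 forward_prob "\<lambda>_ _ _. 1"] forward_prob_measurable forward_prob_01
      by (simp add: SE_eq symbols_per_bit_def fwd)
    ultimately show ?thesis
      by (simp only: sum_subtractf[symmetric], intro sum.cong refl)
         (simp add: algebra_simps add_divide_distrib diff_divide_distrib)
  qed
  also have "(\<Sum>l=1..Nr - 1. LINT \<omega>|M. S l \<omega> * of_bool (E {1..l} (?c l) \<omega>)) = ?B"
  proof (rule sum.cong[OF refl])
    fix l assume l: "l \<in> {1..Nr - 1}"
    then have l': "l \<le> Nr" "{1..l} \<subseteq> {1..Nr}" "1 \<le> l" by auto
    have "(LINT \<omega>|M. S l \<omega> * of_bool (E {1..l} (?c l) \<omega>))
      = (\<Sum>i=1..N. \<Sum>j\<in>{1..l} \<rightarrow>\<^sub>E {1..N}. 1 / symbols_per_bit R i j l *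
         ((LBINT x=th1 i..th1 (Suc i). forward_prob i x * p1 x) *
          (\<Prod>k=1..l. LBINT x=th2 (j k)..th2 (Suc (j k)). relay_prob (?c l k) (j k) x * p2 x)))"
      unfolding SE_eq[OF l'(1,2)]
      by (intro snr_exp l' forward_prob_measurable forward_prob_01 relay_prob_measurable relay_prob_01)
    also have "\<dots> = (\<Sum>n=1..N. \<Sum>m\<in>{1..l} \<rightarrow>\<^sub>E {1..N}.
         (1 - \<epsilon> n) / symbols_per_bit R n m l * avg_PER PER th1 p1 n * mode_prob th1 p1 n
         * (\<Prod>k=1..l - 1. ?b (m k)) * (1 - avg_PER PER th2 p2 (m l)) * mode_prob th2 p2 (m l))"
    proof (intro sum.cong refl)
      fix i j assume i: "i \<in> {1..N}" and j: "j \<in> {1..l} \<rightarrow>\<^sub>E {1..N}"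
      have "(\<Prod>k=1..l. LBINT x=th2 (j k)..th2 (Suc (j k)). relay_prob (?c l k) (j k) x * p2 x)
         = (\<Prod>k=1..l. if k = l then (1 - avg_PER PER th2 p2 (j k)) * mode_prob th2 p2 (j k) else ?b (j k))"
        using fail[OF PiE_mem[OF j]] succ[OF PiE_mem[OF j]] by (intro prod.cong) auto
      then show "1 / symbols_per_bit R i j l *
         ((LBINT x=th1 i..th1 (Suc i). forward_prob i x * p1 x) *
          (\<Prod>k=1..l. LBINT x=th2 (j k)..th2 (Suc (j k)). relay_prob (?c l k) (j k) x * p2 x))
        = (1 - \<epsilon> i) / symbols_per_bit R i j l * avg_PER PER th1 p1 i * mode_prob th1 p1 i
         * (\<Prod>k=1..l - 1. ?b (j k)) * (1 - avg_PER PER th2 p2 (j l)) * mode_prob th2 p2 (j l)"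
        by (simp only: fwd[OF i] split_last[OF l'(3)]) simp
    qed
    finally show "(LINT \<omega>|M. S l \<omega> * of_bool (E {1..l} (?c l) \<omega>)) = \<dots>" .
  qed
  also have "(LINT \<omega>|M. S Nr \<omega> * of_bool (E {1..Nr - 1} (\<lambda>_. Failure) \<omega>)) = ?C"
  proof -
    \<comment> \<open>Padding the product with the factor 1 at \<open>Nr\<close> keeps the mode of
      the last retransmission in the expectation without constraining its outcome; its cell integral
      is then the plain \<open>mode_prob\<close>.\<close>
    let ?v = "\<lambda>k n x. if k = Nr then 1 else relay_prob Failure n x"
    have sub: "{1..Nr - 1} \<subseteq> {1..Nr}" by auto
    have "(LINT \<omega>|M. S Nr \<omega> * of_bool (E {1..Nr - 1} (\<lambda>_. Failure) \<omega>))
      = (LINT \<omega>|M. S Nr \<omega> * (forward_prob (source_mode \<omega>) (\<gamma>1 \<omega>) * (\<Prod>k=1..Nr. ?v k (relay_mode \<omega> k) (\<gamma>2 k \<omega>))))"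
      unfolding SE_eq[OF order_refl sub] split_last[OF Nr] by simp
    also have "\<dots> = (\<Sum>i=1..N. \<Sum>j\<in>{1..Nr} \<rightarrow>\<^sub>E {1..N}. 1 / symbols_per_bit R i j Nr *
         ((LBINT x=th1 i..th1 (Suc i). forward_prob i x * p1 x) *
          (\<Prod>k=1..Nr. LBINT x=th2 (j k)..th2 (Suc (j k)). ?v k (j k) x * p2 x)))"
    proof (rule snr_exp[OF order_refl forward_prob_measurable forward_prob_01])
      show "?v k n \<in> borel_measurable (restrict_space borel {0..})" if "n \<le> N" for k n
        using relay_prob_measurable[OF that, of Failure] by (cases "k = Nr") auto
      show "?v k n x \<in> {0..1}" if "n \<le> N" "0 \<le> x" for k n x
        using relay_prob_01[OF that, of Failure] by auto
    qed
    also have "\<dots> = ?C"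
    proof (intro sum.cong refl)
      fix i j assume i: "i \<in> {1..N}" and j: "j \<in> {1..Nr} \<rightarrow>\<^sub>E {1..N}"
      have "(\<Prod>k=1..Nr. LBINT x=th2 (j k)..th2 (Suc (j k)). ?v k (j k) x * p2 x)
         = (\<Prod>k=1..Nr. if k = Nr then mode_prob th2 p2 (j k) else ?b (j k))"
        using fail[OF PiE_mem[OF j]] by (intro prod.cong) (auto simp: mode_prob_def)
      then show "1 / symbols_per_bit R i j Nr *
         ((LBINT x=th1 i..th1 (Suc i). forward_prob i x * p1 x) *
          (\<Prod>k=1..Nr. LBINT x=th2 (j k)..th2 (Suc (j k)). ?v k (j k) x * p2 x))
        = (1 - \<epsilon> i) * avg_PER PER th1 p1 i * mode_prob th1 p1 i * mode_prob th2 p2 (j Nr)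
           / symbols_per_bit R i j Nr * (\<Prod>k=1..Nr - 1. ?b (j k))"
        by (simp only: fwd[OF i] split_last[OF Nr]) simp
    qed
    finally show ?thesis .
  qed
  finally show ?thesis .
qed

end

theorem proposition1:
  fixes M :: "'w measure"
    and N Nr :: nat
    and R :: "nat \<Rightarrow> real"
    and th1 th2 :: "nat \<Rightarrow> ereal"
    and p1 p2 :: "real \<Rightarrow> real"
    and PER :: "nat \<Rightarrow> real \<Rightarrow> real"
    and \<gamma>sr :: real
    and \<epsilon> :: "nat \<Rightarrow> real"
    and \<gamma>1 :: "'w \<Rightarrow> real"
    and \<gamma>2 :: "nat \<Rightarrow> 'w \<Rightarrow> real"
    and Tsd Tsr :: "'w \<Rightarrow> outcome"
    and Trd :: "nat \<Rightarrow> 'w \<Rightarrow> outcome"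
  defines "\<epsilon> \<equiv> \<lambda>n. PER n \<gamma>sr"
  assumes "prob_space M"
    and "N \<ge> 1" and "Nr \<ge> 1"
    and "R 0 = 0" and "\<And>n. n \<in> {1..N} \<Longrightarrow> R n > 0"
    and "th1 0 = 0" and "th1 (Suc N) = \<infinity>" and "strict_mono_on {0..Suc N} th1"
    and "th2 0 = 0" and "th2 (Suc N) = \<infinity>" and "strict_mono_on {0..Suc N} th2"
    and "\<And>n. n \<le> N \<Longrightarrow> PER n \<in> borel_measurable (restrict_space borel {0..})"
    and "\<And>n x. n \<le> N \<Longrightarrow> x \<ge> 0 \<Longrightarrow> PER n x \<in> {0..1}"
    and "\<gamma>sr \<ge> 0"
    and "\<And>\<omega>. \<omega> \<in> space M \<Longrightarrow> \<gamma>1 \<omega> \<ge> 0"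
    and "\<And>k \<omega>. k \<in> {1..Nr} \<Longrightarrow> \<omega> \<in> space M \<Longrightarrow> \<gamma>2 k \<omega> \<ge> 0"
    and "\<And>x. p1 x \<ge> 0" and "distributed M lborel \<gamma>1 (\<lambda>x. ennreal (p1 x))"
    and "\<And>x. p2 x \<ge> 0"
    and "\<And>k. k \<in> {1..Nr} \<Longrightarrow> distributed M lborel (\<gamma>2 k) (\<lambda>x. ennreal (p2 x))"
    and "prob_space.indep_vars M (\<lambda>_. borel) (\<lambda>k. if k = 0 then \<gamma>1 else \<gamma>2 k) {0..Nr}"
    and "\<And>n. n \<in> {1..N} \<Longrightarrow> mode_prob th1 p1 n > 0"
    and "\<And>m. m \<in> {1..N} \<Longrightarrow> mode_prob th2 p2 m > 0"
    and "Tsd \<in> measurable M (count_space UNIV)"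
    and "Tsr \<in> measurable M (count_space UNIV)"
    and "\<And>k. k \<in> {1..Nr} \<Longrightarrow> Trd k \<in> measurable M (count_space UNIV)"
    and "\<And>a b c. AE \<omega> in M.
           cond_prob_alg M (snr_algebra M Nr \<gamma>1 \<gamma>2)
             (\<lambda>\<omega>. Tsd \<omega> = a \<and> Tsr \<omega> = b \<and> (\<forall>k\<in>{1..Nr}. Trd k \<omega> = c k)) \<omega> =
           cond_prob_alg M (snr_algebra M Nr \<gamma>1 \<gamma>2) (\<lambda>\<omega>. Tsd \<omega> = a) \<omega> *
           cond_prob_alg M (snr_algebra M Nr \<gamma>1 \<gamma>2) (\<lambda>\<omega>. Tsr \<omega> = b) \<omega> *
           (\<Prod>k=1..Nr. cond_prob_alg M (snr_algebra M Nr \<gamma>1 \<gamma>2) (\<lambda>\<omega>. Trd k \<omega> = c k) \<omega>)"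
    and "AE \<omega> in M. cond_prob_alg M (snr_algebra M Nr \<gamma>1 \<gamma>2) (\<lambda>\<omega>. Tsd \<omega> = Failure) \<omega> =
           PER (amc_mode N th1 (\<gamma>1 \<omega>)) (\<gamma>1 \<omega>)"
    and "AE \<omega> in M. cond_prob_alg M (snr_algebra M Nr \<gamma>1 \<gamma>2) (\<lambda>\<omega>. Tsr \<omega> = Failure) \<omega> =
           \<epsilon> (amc_mode N th1 (\<gamma>1 \<omega>))"
    and "\<And>k. k \<in> {1..Nr} \<Longrightarrow>
           AE \<omega> in M. cond_prob_alg M (snr_algebra M Nr \<gamma>1 \<gamma>2) (\<lambda>\<omega>. Trd k \<omega> = Failure) \<omega> =
             PER (amc_mode N th2 (\<gamma>2 k \<omega>)) (\<gamma>2 k \<omega>)"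
  shows "avg_spectral_efficiency M N Nr R th1 th2 \<gamma>1 \<gamma>2 Tsd Tsr Trd =
      (\<Sum>n=1..N. (1 - (1 - \<epsilon> n) * avg_PER PER th1 p1 n) / symbols_per_bit R n (\<lambda>_. 0) 0
                   * mode_prob th1 p1 n)
    + (\<Sum>l=1..Nr - 1. \<Sum>n=1..N. \<Sum>m\<in>{1..l} \<rightarrow>\<^sub>E {1..N}.
         (1 - \<epsilon> n) / symbols_per_bit R n m l * avg_PER PER th1 p1 n * mode_prob th1 p1 n
         * (\<Prod>k=1..l - 1. avg_PER PER th2 p2 (m k) * mode_prob th2 p2 (m k))
         * (1 - avg_PER PER th2 p2 (m l)) * mode_prob th2 p2 (m l))
    + (\<Sum>n=1..N. \<Sum>m\<in>{1..Nr} \<rightarrow>\<^sub>E {1..N}.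
         (1 - \<epsilon> n) * avg_PER PER th1 p1 n * mode_prob th1 p1 n * mode_prob th2 p2 (m Nr)
           / symbols_per_bit R n m Nr
         * (\<Prod>k=1..Nr - 1. avg_PER PER th2 p2 (m k) * mode_prob th2 p2 (m k)))"
proof -
  \<comment> \<open>Nonnegativity of the constant S-R SNR places it where \<open>PER n\<close> is
    known to take values in \<open>[0,1]\<close>.\<close>
  have \<epsilon>_01: "\<epsilon> n \<in> {0..1}" if "n \<le> N" for n
    unfolding \<epsilon>_def using assms(14)[OF that assms(15)] .
  interpret prob_space M by fact
  interpret arq_model M N th1 th2 Nr R p1 p2 PER \<epsilon> \<gamma>1 \<gamma>2 Tsd Tsr Trd
    by unfold_locales (fact assms \<epsilon>_01)+
  show ?thesis
    by (rule avg_spectral_efficiency_formula) fact+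
qed

end
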